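(* Let $L\ge2$ and suppose Assumptions 1, 2, 4 and 5 hold. Then the gradient descent iterates satisfy: (i) $\lim_{t\to\infty}\mathcal{R}(W(t))=0$; (ii) for every $1\le k\le L$, $\lim_{t\to\infty}\|W_k(t)\|_F=\infty$; (iii) $\lim_{t\to\infty}\left|\left\langle\frac{w_{\mathrm{prod}}(t)}{\prod_{k=1}^L\|W_k(t)\|_F},v_1(t)\right\rangle\right|=1$, where $v_1(t)$ is a first right singular vector of $W_1(t)$.
   Context: Setting: data $(x_i,y_i)_{i=1}^n$ with $x_i\in\mathbb{R}^d$, $\|x_i\|\le 1$, $y_i\in\{-1,+1\}$; $z_i:=y_ix_i$; the data are linearly separable. A depth-$L$ linear network is $W=(W_L,\dots,W_1)$ with $W_k\in\mathbb{R}^{d_k\times d_{k-1}}$, $d_0=d$, $d_L=1$, $w_{\mathrm{prod}}:=(W_L\cdots W_1)^\top$, and $\mathcal{R}(W)=\frac1n\sum_{i=1}^n\ell(\langle w_{\mathrm{prod}},z_i\rangle)$. $B(R):=\{W:\max_k\|W_k\|_F\le R\}$. Gradient descent: $W(t+1)=W(t)-\eta_t\nabla\mathcal{R}(W(t))$, $t=0,1,2,\dots$. Assumption 1: $\ell$ is continuously differentiable, $\ell'<0$ everywhere, $\lim_{x\to-\infty}\ell(x)=\infty$, $\lim_{x\to\infty}\ell(x)=0$. Assumption 2: $\nabla\mathcal{R}(W(0))\ne0$ and $\mathcal{R}(W(0))\le\ell(0)$. Assumption 4: $\ell'$ is $\beta$-Lipschitz and $|\ell'|\le G$. Let $\beta(R):=2L^2R^{2L-2}(\beta+G)$.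 Assumption 5: $\eta_t=\min\{1/\beta(R_t),1\}$, where the radii $R_t$ satisfy $W(t)\in B(R_t-1)$ for every $t$, and $R_{t+1}=R_t$ whenever $W(t+1)\in B(R_t-1)$. *)

theory Defs
  imports "HOL-Analysis.Analysis"
begin

text \<open>Conventions. A depth-L linear network is a function
  W :: nat => nat => nat => real, where W k i j is entry (i,j) of layer W_k
  (1 <= k <= L, i < dims k, j < dims (k-1)). Dimensions are dims :: nat => nat,
  dims 0 = d (input dimension), dims L = 1. Data: x i j is coordinate j < d of sample
  i < n, labels y i. Vectors in R^d are functions nat => real restricted to indices < d.\<close>

type_synonym net = "nat \<Rightarrow> nat \<Rightarrow> nat \<Rightarrow> real"

fun prodmat :: "nat \<Rightarrow> (nat \<Rightarrow> nat) \<Rightarrow> net \<Rightarrow> nat \<Rightarrow> nat \<Rightarrow> nat \<Rightarrow> real" where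
  "prodmat L dims W 0 i j = (if i = j then 1 else 0)"
| "prodmat L dims W (Suc k) i j = (\<Sum>m<dims k. W (Suc k) i m * prodmat L dims W k m j)"

definition wprod :: "nat \<Rightarrow> (nat \<Rightarrow> nat) \<Rightarrow> net \<Rightarrow> nat \<Rightarrow> real" where
  "wprod L dims W j = prodmat L dims W L 0 j"

definition risk :: "(real \<Rightarrow> real) \<Rightarrow> nat \<Rightarrow> (nat \<Rightarrow> nat \<Rightarrow> real) \<Rightarrow> (nat \<Rightarrow> real)
    \<Rightarrow> nat \<Rightarrow> (nat \<Rightarrow> nat) \<Rightarrow> net \<Rightarrow> real" where
  "risk loss n x y L dims W =
     (1 / real n) * (\<Sum>i<n. loss (\<Sum>j<dims 0. wprod L dims W j * (y i * x i j)))"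

definition grad_risk :: "(real \<Rightarrow> real) \<Rightarrow> nat \<Rightarrow> (nat \<Rightarrow> nat \<Rightarrow> real) \<Rightarrow> (nat \<Rightarrow> real)
    \<Rightarrow> nat \<Rightarrow> (nat \<Rightarrow> nat) \<Rightarrow> net \<Rightarrow> net" where
  "grad_risk loss n x y L dims W k i j =
     deriv (\<lambda>s. risk loss n x y L dims (W(k := (W k)(i := (W k i)(j := s))))) (W k i j)"

definition fnorm :: "(nat \<Rightarrow> nat) \<Rightarrow> net \<Rightarrow> nat \<Rightarrow> real" where
  "fnorm dims W k = sqrt (\<Sum>i<dims k. \<Sum>j<dims (k - 1). (W k i j)\<^sup>2)"

definition in_ball :: "nat \<Rightarrow> (nat \<Rightarrow> nat) \<Rightarrow> real \<Rightarrow> net \<Rightarrow> bool" where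
  "in_ball L dims R W \<longleftrightarrow> (\<forall>k\<in>{1..L}. fnorm dims W k \<le> R)"

definition first_right_sing_vec :: "(nat \<Rightarrow> nat) \<Rightarrow> net \<Rightarrow> (nat \<Rightarrow> real) \<Rightarrow> bool" where
  "first_right_sing_vec dims W v \<longleftrightarrow>
     (\<Sum>j<dims 0. (v j)\<^sup>2) = 1 \<and>
     (\<forall>u. (\<Sum>j<dims 0. (u j)\<^sup>2) = 1 \<longrightarrow>
        (\<Sum>i<dims 1. (\<Sum>j<dims 0. W 1 i j * u j)\<^sup>2) \<le> (\<Sum>i<dims 1. (\<Sum>j<dims 0. W 1 i j * v j)\<^sup>2))"

end

theory Submission
  imports Defs
begin

text \<open>The step size bound gives a sufficient decrease of the risk per step; hence the squared gradients,
  weighted by the step sizes, are summable. Gradient descent changes \<open>W\<^sub>k\<^sub>+\<^sub>1\<^sup>T W\<^sub>k\<^sub>+\<^sub>1 - W\<^sub>k W\<^sub>k\<^sup>T\<close> only to second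
  order in the step size, so these matrices stay bounded. If the risk stayed above some \<open>c > 0\<close>, then
  separability would bound its gradient with respect to \<open>w\<^sub>p\<^sub>r\<^sub>o\<^sub>d\<close> away from zero, and, \<open>w\<^sub>p\<^sub>r\<^sub>o\<^sub>d\<close> itself being bounded
  away from zero, \<open>\<parallel>\<partial>R/\<partial>W\<^sub>1\<parallel> \<ge> const / \<parallel>W\<^sub>1\<parallel>\<close>. The risk then controls \<open>ln \<parallel>W\<^sub>1\<parallel>\<close>, all layers remain bounded,
  and the risk drops by a fixed amount per step, which is absurd. So the risk tends to zero and the layers
  grow without bound. After normalisation, \<open>W\<^sub>k\<^sub>+\<^sub>1\<^sup>T W\<^sub>k\<^sub>+\<^sub>1 - W\<^sub>k W\<^sub>k\<^sup>T\<close> tends to zero; as the last layer has rank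
  one, downward induction shows that every layer approaches the rank one matrix \<open>p\<^sub>k p\<^sub>k\<^sub>-\<^sub>1\<^sup>T\<close>, where \<open>p\<^sub>k\<^sup>T\<close> is
  the product of the layers above \<open>k\<close>.\<close>

subsection \<open>Forward and backward products\<close>

text \<open>Layers act on an input vector here, so that no product of matrices has to be handled.
  The columns of \<open>prodmat\<close> are the images of the unit vectors.\<close>

fun fwd :: "(nat \<Rightarrow> nat) \<Rightarrow> net \<Rightarrow> (nat \<Rightarrow> real) \<Rightarrow> nat \<Rightarrow> nat \<Rightarrow> real" where
  "fwd dims W z 0 i = z i"
| "fwd dims W z (Suc k) i = (\<Sum>m<dims k. W (Suc k) i m * fwd dims W z k m)"

text \<open>The recursion counts layers from the top, which makes it structural; \<open>lft\<close>
  translates back to layer indices. The start value 1 is the one by one identity matrix.\<close>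

fun bwd :: "nat \<Rightarrow> (nat \<Rightarrow> nat) \<Rightarrow> net \<Rightarrow> nat \<Rightarrow> nat \<Rightarrow> real" where
  "bwd L dims W 0 j = 1"
| "bwd L dims W (Suc r) j = (\<Sum>i<dims (L - r). bwd L dims W r i * W (L - r) i j)"

text \<open>The row vector \<open>W\<^sub>L \<cdots> W\<^sub>k\<^sub>+\<^sub>1\<close>, on the assumption \<open>dims L = 1\<close>.\<close>

definition lft :: "nat \<Rightarrow> (nat \<Rightarrow> nat) \<Rightarrow> net \<Rightarrow> nat \<Rightarrow> nat \<Rightarrow> real" where
  "lft L dims W k = bwd L dims W (L - k)"

lemma lft_top [simp]: "lft L dims W L j = 1"
  by (simp add: lft_def)

lemma lft_step:
  assumes "k < L"
  shows "lft L dims W k j = (\<Sum>i<dims (Suc k). lft L dims W (Suc k) i * W (Suc k) i j)"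
proof -
  have "L - k = Suc (L - Suc k)" "L - (L - Suc k) = Suc k"
    using assms by auto
  then show ?thesis
    by (simp add: lft_def)
qed

lemma bwd_cong:
  assumes "\<And>m. L - r < m \<Longrightarrow> W m = V m" "r \<le> L"
  shows "bwd L dims W r j = bwd L dims V r j"
  using assms
proof (induction r arbitrary: j)
  case (Suc r)
  have "W (L - r) = V (L - r)"
    using Suc.prems by (intro Suc.prems) auto
  moreover have "bwd L dims W r i = bwd L dims V r i" for i
    using Suc.prems by (intro Suc.IH Suc.prems) auto
  ultimately show ?case by simp
qed simp

text \<open>Together with \<open>fwd_cong\<close> this shows that changing an entry of one layer
  leaves the products above and below that layer alone, so the output is affine in the
  entry.\<close>

lemma lft_cong:
  assumes "\<And>m. k < m \<Longrightarrow> W m = V m" "k \<le> L"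
  shows "lft L dims W k j = lft L dims V k j"
  unfolding lft_def using assms by (intro bwd_cong) auto

lemma fwd_cong:
  assumes "\<And>m. m \<le> k \<Longrightarrow> W m = V m"
  shows "fwd dims W z k i = fwd dims V z k i"
  using assms
proof (induction k arbitrary: i)
  case (Suc k)
  then have "fwd dims W z k i = fwd dims V z k i" for i
    by simp
  with Suc.prems[of "Suc k"] show ?case by simp
qed simp

text \<open>Linearity in the input later merges the gradients of all samples into one term with
  input \<open>gvec\<close>.\<close>

lemma fwd_sum:
  "fwd dims W (\<lambda>j. \<Sum>a\<in>A. c a * z a j) k i = (\<Sum>a\<in>A. c a * fwd dims W (z a) k i)"
proof (induction k arbitrary: i)
  case (Suc k)
  show ?case
    by (simp add: Suc sum_distrib_left mult.left_commute, rule sum.swap)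
qed simp

lemma prodmat_eq_fwd: "prodmat L dims W k i j = fwd dims W (\<lambda>m. if m = j then 1 else 0) k i"
  by (induction k arbitrary: i) auto

text \<open>By associativity the cut between upper and lower layers may be moved. The induction
  moves it down one layer at a time, starting at the output, where the upper product is 1.\<close>

lemma lft_fwd:
  assumes "dims L = 1" "k \<le> L"
  shows "(\<Sum>i<dims k. lft L dims W k i * fwd dims W z k i) = fwd dims W z L 0"
  using assms(2)
proof (induction k rule: inc_induct)
  case base
  then show ?case using assms(1) by simp
next
  case (step k)
  have "(\<Sum>j<dims k. lft L dims W k j * fwd dims W z k j)
      = (\<Sum>j<dims k. \<Sum>i<dims (Suc k). lft L dims W (Suc k) i * W (Suc k) i j * fwd dims W z k j)"
    using step by (simp add: lft_step sum_distrib_right)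
  also have "\<dots> = (\<Sum>i<dims (Suc k). \<Sum>j<dims k. lft L dims W (Suc k) i * W (Suc k) i j * fwd dims W z k j)"
    by (rule sum.swap)
  also have "\<dots> = (\<Sum>i<dims (Suc k). lft L dims W (Suc k) i * fwd dims W z (Suc k) i)"
    by (simp add: sum_distrib_left mult.assoc)
  finally show ?case using step.IH by simp
qed

lemma wprod_eq_lft:
  assumes "dims L = 1" "j < dims 0"
  shows "wprod L dims W j = lft L dims W 0 j"
  using lft_fwd[of dims L 0 W "\<lambda>m. if m = j then 1 else 0"] assms
  by (simp add: wprod_def prodmat_eq_fwd if_distrib[of "(*) _"] cong: if_cong)

lemma wprod_inner:
  assumes "dims L = 1"
  shows "(\<Sum>j<dims 0. wprod L dims W j * z j) = fwd dims W z L 0"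
  using lft_fwd[of dims L 0 W z] assms by (simp add: wprod_eq_lft)

section \<open>Frobenius and Euclidean norm bounds for layers and their products\<close>

lemma fnorm_nonneg [simp]: "0 \<le> fnorm dims W k"
  by (auto simp: fnorm_def intro!: sum_nonneg)

lemma fnorm_sq: "(fnorm dims W k)\<^sup>2 = (\<Sum>i<dims k. \<Sum>j<dims (k - 1). (W k i j)\<^sup>2)"
  by (auto simp: fnorm_def intro!: sum_nonneg)

lemma abs_inner_le_L2_set: "\<bar>\<Sum>i\<in>A. f i * g i\<bar> \<le> L2_set f A * L2_set g A"
  by (rule order_trans[OF sum_abs]) (simp add: abs_mult L2_set_mult_ineq)

lemma L2_set_cmult: "L2_set (\<lambda>i. c * f i) A = \<bar>c\<bar> * L2_set f A"
  by (simp add: L2_set_def power_mult_distrib real_sqrt_mult flip: sum_distrib_left)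

lemma L2_set_sum_le: "L2_set (\<lambda>j. \<Sum>a\<in>A. f a j) B \<le> (\<Sum>a\<in>A. L2_set (f a) B)"
proof (induction A rule: infinite_finite_induct)
  case (insert a A)
  then show ?case
    using L2_set_triangle_ineq[of "f a" "\<lambda>j. \<Sum>a\<in>A. f a j" B] by simp
qed (simp_all add: L2_set_def)

lemma fnorm_eq_L2_set: "fnorm dims W k = L2_set (\<lambda>i. L2_set (W k i) {..<dims (k - 1)}) {..<dims k}"
  by (simp add: fnorm_def L2_set_def sum_nonneg)

lemma fnorm_triangle:
  assumes "\<And>i j. V k i j = W k i j + D k i j"
  shows "fnorm dims V k \<le> fnorm dims W k + fnorm dims D k"
proof -
  have "fnorm dims V k \<le> L2_set (\<lambda>i. L2_set (W k i) {..<dims (k - 1)} + L2_set (D k i) {..<dims (k - 1)}) {..<dims k}"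
    unfolding fnorm_eq_L2_set assms by (intro L2_set_mono L2_set_triangle_ineq) simp
  also have "\<dots> \<le> fnorm dims W k + fnorm dims D k"
    unfolding fnorm_eq_L2_set by (rule L2_set_triangle_ineq)
  finally show ?thesis .
qed

lemma fnorm_rank_one:
  assumes "\<And>i j. i < dims k \<Longrightarrow> j < dims (k - 1) \<Longrightarrow> D k i j = a i * b j"
  shows "fnorm dims D k = L2_set a {..<dims k} * L2_set b {..<dims (k - 1)}"
proof -
  have "fnorm dims D k = L2_set (\<lambda>i. L2_set b {..<dims (k - 1)} * \<bar>a i\<bar>) {..<dims k}"
    unfolding fnorm_eq_L2_set
    by (intro L2_set_cong refl) (simp add: assms L2_set_cmult mult.commute cong: L2_set_cong_simp)
  then show ?thesis
    by (simp add: L2_set_cmult) (simp add: L2_set_def)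
qed

lemma L2_set_matrix_vector:
  "L2_set (\<lambda>i. \<Sum>j\<in>B. M i j * u j) A \<le> sqrt (\<Sum>i\<in>A. \<Sum>j\<in>B. (M i j)\<^sup>2) * L2_set u B"
proof -
  have "(\<Sum>i\<in>A. (\<Sum>j\<in>B. M i j * u j)\<^sup>2) \<le> (\<Sum>i\<in>A. (\<Sum>j\<in>B. (M i j)\<^sup>2) * (\<Sum>j\<in>B. (u j)\<^sup>2))"
    by (intro sum_mono Cauchy_Schwarz_ineq_sum)
  then show ?thesis
    by (simp add: L2_set_def flip: real_sqrt_mult sum_distrib_right)
qed

lemma L2_set_layer:
  "L2_set (\<lambda>i. \<Sum>m<dims k. W (Suc k) i m * u m) {..<dims (Suc k)}
     \<le> fnorm dims W (Suc k) * L2_set u {..<dims k}"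
  using L2_set_matrix_vector[of "\<lambda>i m. W (Suc k) i m" u "{..<dims k}" "{..<dims (Suc k)}"]
  by (simp add: fnorm_def)

lemma L2_set_layer_transpose:
  "L2_set (\<lambda>j. \<Sum>i<dims (Suc k). u i * W (Suc k) i j) {..<dims k}
     \<le> fnorm dims W (Suc k) * L2_set u {..<dims (Suc k)}"
  using L2_set_matrix_vector[of "\<lambda>j i. W (Suc k) i j" u "{..<dims (Suc k)}" "{..<dims k}"]
    sum.swap[of "\<lambda>i j. (W (Suc k) i j)\<^sup>2" "{..<dims k}" "{..<dims (Suc k)}"]
  by (simp add: fnorm_def mult.commute)

lemma in_ballD: "in_ball L dims R W \<Longrightarrow> 1 \<le> k \<Longrightarrow> k \<le> L \<Longrightarrow> fnorm dims W k \<le> R"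
  by (simp add: in_ball_def)

lemma in_ball_nonneg:
  assumes "in_ball L dims R W" "1 \<le> L"
  shows "0 \<le> R"
  using in_ballD[OF assms(1), of 1] assms(2) fnorm_nonneg[of dims W 1] by linarith

lemma L2_set_fwd_le:
  assumes "in_ball L dims R W" "k \<le> L"
  shows "L2_set (fwd dims W z k) {..<dims k} \<le> R ^ k * L2_set z {..<dims 0}"
  using assms(2)
proof (induction k)
  case (Suc k)
  have R: "0 \<le> R" using in_ball_nonneg[OF assms(1)] Suc.prems by simp
  have "L2_set (fwd dims W z (Suc k)) {..<dims (Suc k)}
      \<le> fnorm dims W (Suc k) * L2_set (fwd dims W z k) {..<dims k}"
    using L2_set_layer[where dims = dims and k = k and W = W and u = "fwd dims W z k"]
    by (simp add: L2_set_def)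
  also have "\<dots> \<le> R * (R ^ k * L2_set z {..<dims 0})"
    using Suc R in_ballD[OF assms(1), of "Suc k"] by (intro mult_mono) auto
  finally show ?case by (simp add: mult.assoc del: fwd.simps)
qed (simp add: L2_set_def)

lemma L2_set_lft_le:
  assumes "in_ball L dims R W" "dims L = 1" "k \<le> L"
  shows "L2_set (lft L dims W k) {..<dims k} \<le> R ^ (L - k)"
  using assms(3)
proof (induction k rule: inc_induct)
  case base
  then show ?case using assms(2) by (simp add: L2_set_def)
next
  case (step k)
  have R: "0 \<le> R" using in_ball_nonneg[OF assms(1)] step by simp
  have "L2_set (lft L dims W k) {..<dims k}
      \<le> fnorm dims W (Suc k) * L2_set (lft L dims W (Suc k)) {..<dims (Suc k)}"
    using L2_set_layer_transpose[where dims = dims and k = k and W = W and u = "lft L dims W (Suc k)"] step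
    by (simp add: L2_set_def lft_step)
  also have "\<dots> \<le> R * R ^ (L - Suc k)"
    using step R in_ballD[OF assms(1), of "Suc k"] by (intro mult_mono) auto
  also have "\<dots> = R ^ (L - k)"
    using step.hyps by (simp flip: power_Suc add: Suc_diff_Suc)
  finally show ?case .
qed

section \<open>Linearisation of the layer outputs, with error bounds\<close>

text \<open>Derivative at \<open>W\<close> in direction \<open>D\<close> of the layer outputs \<open>W\<^sub>k \<cdots> W\<^sub>1 z\<close>.\<close>

fun lin :: "(nat \<Rightarrow> nat) \<Rightarrow> net \<Rightarrow> net \<Rightarrow> (nat \<Rightarrow> real) \<Rightarrow> nat \<Rightarrow> nat \<Rightarrow> real" where
  "lin dims W D z 0 i = 0"
| "lin dims W D z (Suc k) i = (\<Sum>m<dims k. W (Suc k) i m * lin dims W D z k m)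
     + (\<Sum>m<dims k. D (Suc k) i m * fwd dims W z k m)"

text \<open>Pairing with the upper product absorbs the next layer into it, so the recursion of
  \<open>lin\<close> unrolls into one term per perturbed layer. With the gradient as direction these
  terms become squared gradient entries.\<close>

lemma lft_lin:
  assumes "k \<le> L"
  shows "(\<Sum>i<dims k. lft L dims W k i * lin dims W D z k i)
    = (\<Sum>l=1..k. \<Sum>i<dims l. \<Sum>j<dims (l - 1). lft L dims W l i * D l i j * fwd dims W z (l - 1) j)"
  using assms
proof (induction k)
  case (Suc k)
  have "(\<Sum>i<dims (Suc k). lft L dims W (Suc k) i * lin dims W D z (Suc k) i)
     = (\<Sum>i<dims (Suc k). \<Sum>m<dims k. lft L dims W (Suc k) i * W (Suc k) i m * lin dims W D z k m)
     + (\<Sum>i<dims (Suc k). \<Sum>m<dims k. lft L dims W (Suc k) i * D (Suc k) i m * fwd dims W z k m)"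
    by (simp add: distrib_left sum.distrib sum_distrib_left mult.assoc)
  also have "(\<Sum>i<dims (Suc k). \<Sum>m<dims k. lft L dims W (Suc k) i * W (Suc k) i m * lin dims W D z k m)
     = (\<Sum>m<dims k. \<Sum>i<dims (Suc k). lft L dims W (Suc k) i * W (Suc k) i m * lin dims W D z k m)"
    by (rule sum.swap)
  also have "\<dots> = (\<Sum>m<dims k. lft L dims W k m * lin dims W D z k m)"
    using Suc.prems by (simp add: lft_step sum_distrib_right)
  finally show ?case using Suc by simp
qed simp

lemma lin_sum:
  "lin dims W D (\<lambda>j. \<Sum>a\<in>A. c a * z a j) k i = (\<Sum>a\<in>A. c a * lin dims W D (z a) k i)"
proof (induction k arbitrary: i)
  case (Suc k)
  have swap: "(\<Sum>m\<in>B. h m * (\<Sum>a\<in>A. c a * f a m)) = (\<Sum>a\<in>A. c a * (\<Sum>m\<in>B. h m * f a m))"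
    for B and h :: "nat \<Rightarrow> real" and f :: "'a \<Rightarrow> nat \<Rightarrow> real"
    by (simp add: sum_distrib_left mult.left_commute, rule sum.swap)
  show ?case
    by (simp add: Suc fwd_sum swap distrib_left sum.distrib)
qed simp

lemma lin_top:
  assumes "dims L = 1"
  shows "lin dims W D z L 0
    = (\<Sum>l=1..L. \<Sum>i<dims l. \<Sum>j<dims (l - 1). lft L dims W l i * D l i j * fwd dims W z (l - 1) j)"
  using lft_lin[of L L dims W D z] assms by simp

text \<open>The new error is the old one passed through the perturbed layer, plus the perturbation
  applied to the old output. Thus each of the k layers contributes \<delta> times k - 1 factors
  R.\<close>

lemma L2_set_fwd_diff_le:
  assumes W: "in_ball L dims R W" and V: "in_ball L dims R V"
    and VW: "\<And>k i j. V k i j = W k i j + D k i j"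
    and D: "\<And>k. 1 \<le> k \<Longrightarrow> k \<le> L \<Longrightarrow> fnorm dims D k \<le> \<delta>"
    and z: "L2_set z {..<dims 0} \<le> 1" and "k \<le> L"
  shows "L2_set (\<lambda>i. fwd dims V z k i - fwd dims W z k i) {..<dims k} \<le> real k * R ^ (k - 1) * \<delta>"
  using \<open>k \<le> L\<close>
proof (induction k)
  case (Suc k)
  let ?e = "\<lambda>m. fwd dims V z k m - fwd dims W z k m"
  have R: "0 \<le> R" using in_ball_nonneg[OF W] Suc.prems by simp
  have \<delta>: "0 \<le> \<delta>" using D[of 1] fnorm_nonneg[of dims D 1] Suc.prems by linarith
  have eq: "fwd dims V z (Suc k) i - fwd dims W z (Suc k) i
    = (\<Sum>m<dims k. V (Suc k) i m * ?e m) + (\<Sum>m<dims k. D (Suc k) i m * fwd dims W z k m)" for i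
    by (simp add: VW algebra_simps sum.distrib sum_subtractf)
  have "L2_set (\<lambda>i. fwd dims V z (Suc k) i - fwd dims W z (Suc k) i) {..<dims (Suc k)}
    \<le> L2_set (\<lambda>i. \<Sum>m<dims k. V (Suc k) i m * ?e m) {..<dims (Suc k)}
     + L2_set (\<lambda>i. \<Sum>m<dims k. D (Suc k) i m * fwd dims W z k m) {..<dims (Suc k)}"
    unfolding eq by (rule L2_set_triangle_ineq)
  also have "\<dots> \<le> fnorm dims V (Suc k) * L2_set ?e {..<dims k}
      + fnorm dims D (Suc k) * L2_set (fwd dims W z k) {..<dims k}"
    by (intro add_mono L2_set_layer)
  also have "\<dots> \<le> R * (real k * R ^ (k - 1) * \<delta>) + \<delta> * (R ^ k * 1)"
  proof (intro add_mono mult_mono)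
    show "L2_set (fwd dims W z k) {..<dims k} \<le> R ^ k * 1"
      using L2_set_fwd_le[OF W, of k z] Suc.prems mult_left_mono[OF z zero_le_power[OF R], of k]
      by simp
  qed (use Suc R \<delta> D in_ballD[OF V, of "Suc k"] in auto)
  also have "\<dots> = real (Suc k) * R ^ (Suc k - 1) * \<delta>"
    by (cases k) (simp_all add: algebra_simps)
  finally show ?case .
qed (simp add: L2_set_def)

text \<open>Each layer adds a product of its perturbation with the first order error below it. The
  constants close up because k^2 + k is at most (k + 1)^2, and R being at least 1 lets powers of R
  be raised to a common exponent.\<close>

lemma L2_set_fwd_taylor_le:
  assumes W: "in_ball L dims R W" and V: "in_ball L dims R V" and R: "1 \<le> R"
    and VW: "\<And>k i j. V k i j = W k i j + D k i j"
    and D: "\<And>k. 1 \<le> k \<Longrightarrow> k \<le> L \<Longrightarrow> fnorm dims D k \<le> \<delta>"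
    and z: "L2_set z {..<dims 0} \<le> 1" and "k \<le> L"
  shows "L2_set (\<lambda>i. fwd dims V z k i - fwd dims W z k i - lin dims W D z k i) {..<dims k}
    \<le> (real k)\<^sup>2 * R ^ (k - 1) * \<delta>\<^sup>2"
  using \<open>k \<le> L\<close>
proof (induction k)
  case (Suc k)
  let ?e = "\<lambda>m. fwd dims V z k m - fwd dims W z k m"
  let ?r = "\<lambda>m. ?e m - lin dims W D z k m"
  have \<delta>: "0 \<le> \<delta>" using D[of 1] fnorm_nonneg[of dims D 1] Suc.prems by linarith
  have eq: "fwd dims V z (Suc k) i - fwd dims W z (Suc k) i - lin dims W D z (Suc k) i
    = (\<Sum>m<dims k. W (Suc k) i m * ?r m) + (\<Sum>m<dims k. D (Suc k) i m * ?e m)" for i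
    by (simp add: VW algebra_simps sum.distrib sum_subtractf)
  have "L2_set (\<lambda>i. fwd dims V z (Suc k) i - fwd dims W z (Suc k) i - lin dims W D z (Suc k) i) {..<dims (Suc k)}
    \<le> L2_set (\<lambda>i. \<Sum>m<dims k. W (Suc k) i m * ?r m) {..<dims (Suc k)}
     + L2_set (\<lambda>i. \<Sum>m<dims k. D (Suc k) i m * ?e m) {..<dims (Suc k)}"
    unfolding eq by (rule L2_set_triangle_ineq)
  also have "\<dots> \<le> fnorm dims W (Suc k) * L2_set ?r {..<dims k}
      + fnorm dims D (Suc k) * L2_set ?e {..<dims k}"
    by (intro add_mono L2_set_layer)
  also have "\<dots> \<le> R * ((real k)\<^sup>2 * R ^ (k - 1) * \<delta>\<^sup>2) + \<delta> * (real k * R ^ (k - 1) * \<delta>)"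
    using Suc R \<delta> D in_ballD[OF W, of "Suc k"] L2_set_fwd_diff_le[OF W V VW D z, of k]
    by (intro add_mono mult_mono) auto
  also have "\<dots> = ((real k)\<^sup>2 * R ^ k + real k * R ^ (k - 1)) * \<delta>\<^sup>2"
    by (cases k) (simp_all add: algebra_simps power2_eq_square)
  also have "\<dots> \<le> ((real k)\<^sup>2 * R ^ k + real k * R ^ k) * \<delta>\<^sup>2"
    using R by (intro mult_right_mono add_left_mono mult_left_mono power_increasing) auto
  also have "\<dots> \<le> ((real (Suc k))\<^sup>2 * R ^ k) * \<delta>\<^sup>2"
    using R by (intro mult_right_mono) (auto simp: power2_eq_square algebra_simps)
  finally show ?case by simp
qed (simp add: L2_set_def)

section \<open>Entries of the matrices W_(k+1)^T W_(k+1) - W_k W_k^T\<close>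

definition imbalance :: "(nat \<Rightarrow> nat) \<Rightarrow> net \<Rightarrow> nat \<Rightarrow> nat \<Rightarrow> nat \<Rightarrow> real" where
  "imbalance dims V k i j = (\<Sum>m<dims (Suc k). V (Suc k) m i * V (Suc k) m j) - (\<Sum>m<dims (k - 1). V k i m * V k j m)"

lemma L2_set_row_le:
  assumes "i < dims k"
  shows "L2_set (V k i) {..<dims (k - 1)} \<le> fnorm dims V k"
  unfolding fnorm_eq_L2_set using assms
  by (intro member_le_L2_set[of "{..<dims k}" i "\<lambda>i. L2_set (V k i) {..<dims (k - 1)}"]) auto

lemma L2_set_column_le:
  assumes "j < dims (k - 1)"
  shows "L2_set (\<lambda>i. V k i j) {..<dims k} \<le> fnorm dims V k"
  unfolding fnorm_def L2_set_def using assms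
  by (intro real_sqrt_le_mono sum_mono member_le_sum[of j "{..<dims (k - 1)}" "\<lambda>j. (V k _ j)\<^sup>2"]) auto

lemma abs_imbalance_le:
  assumes "i < dims k" "j < dims k"
  shows "\<bar>imbalance dims V k i j\<bar> \<le> (fnorm dims V (Suc k))\<^sup>2 + (fnorm dims V k)\<^sup>2"
proof -
  have "\<bar>\<Sum>m<dims (Suc k). V (Suc k) m i * V (Suc k) m j\<bar> \<le> fnorm dims V (Suc k) * fnorm dims V (Suc k)"
    using L2_set_column_le[of i dims "Suc k" V] L2_set_column_le[of j dims "Suc k" V] assms
    by (intro order_trans[OF abs_inner_le_L2_set] mult_mono) auto
  moreover have "\<bar>\<Sum>m<dims (k - 1). V k i m * V k j m\<bar> \<le> fnorm dims V k * fnorm dims V k"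
    using assms by (intro order_trans[OF abs_inner_le_L2_set] mult_mono L2_set_row_le) auto
  ultimately show ?thesis by (simp add: imbalance_def power2_eq_square)
qed

text \<open>The trace of the imbalance compares the norms of adjacent layers, so bounded entries
  keep these norms close.\<close>

lemma sum_imbalance: "(\<Sum>i<dims k. imbalance dims V k i i) = (fnorm dims V (Suc k))\<^sup>2 - (fnorm dims V k)\<^sup>2"
  using sum.swap[of "\<lambda>i m. (V (Suc k) m i)\<^sup>2" "{..<dims (Suc k)}" "{..<dims k}"]
  unfolding fnorm_sq by (simp add: imbalance_def sum_subtractf power2_eq_square)

subsection \<open>Asymptotically rank one layers\<close>

lemma tendsto_zero_Bseq_mult:
  fixes f g :: "nat \<Rightarrow> real"
  assumes "Bseq f" "g \<longlonglongrightarrow> 0"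
  shows "(\<lambda>t. f t * g t) \<longlonglongrightarrow> 0"
  using bounded_bilinear.Bfun_prod_Zfun[OF bounded_bilinear_mult assms(1), of g] assms(2)
  by (simp add: tendsto_Zfun_iff)

lemma Bseq_if_sum_squares_tendsto:
  fixes q :: "nat \<Rightarrow> 'a \<Rightarrow> real"
  assumes "(\<lambda>t. \<Sum>i\<in>A. (q t i)\<^sup>2) \<longlonglongrightarrow> c" "finite A" "i \<in> A"
  shows "Bseq (\<lambda>t. q t i)"
proof -
  obtain K where K: "K > 0" "\<And>t. norm (\<Sum>i\<in>A. (q t i)\<^sup>2) \<le> K"
    using convergent_imp_Bseq[OF convergentI[OF assms(1)]] by (auto elim: BseqE)
  have "norm (q t i) \<le> sqrt K" for t
  proof -
    have "(q t i)\<^sup>2 \<le> (\<Sum>i\<in>A. (q t i)\<^sup>2)"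
      using assms by (intro member_le_sum) auto
    then have "(q t i)\<^sup>2 \<le> K" using K(2)[of t] by simp
    then show ?thesis by (simp add: real_le_rsqrt)
  qed
  then show ?thesis by (rule BseqI')
qed

lemma tendsto_zero_if_square:
  fixes f :: "nat \<Rightarrow> real"
  assumes "(\<lambda>t. (f t)\<^sup>2) \<longlonglongrightarrow> 0"
  shows "f \<longlonglongrightarrow> 0"
  using tendsto_real_sqrt[OF assms] by (simp add: tendsto_rabs_zero_iff)

lemma Bseq_plus:
  fixes f g :: "nat \<Rightarrow> real"
  assumes "Bseq f" "Bseq g"
  shows "Bseq (\<lambda>t. f t + g t)"
proof -
  obtain K K' where "\<And>t. norm (f t) \<le> K" "\<And>t. norm (g t) \<le> K'"
    using assms by (metis BseqE)
  then have "norm (f t + g t) \<le> K + K'" for t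
    by (meson add_mono norm_triangle_le)
  then show ?thesis by (rule BseqI')
qed

lemma Bseq_sum:
  fixes f :: "nat \<Rightarrow> 'a \<Rightarrow> real"
  assumes "\<And>i. i \<in> A \<Longrightarrow> Bseq (\<lambda>t. f t i)"
  shows "Bseq (\<lambda>t. \<Sum>i\<in>A. f t i)"
  using assms by (induction A rule: infinite_finite_induct) (auto intro: Bseq_plus)

text \<open>If \<open>M M\<^sup>T\<close> approaches \<open>q q\<^sup>T\<close> with \<open>q\<close> of asymptotically unit norm, then \<open>M\<close> approaches \<open>q p\<^sup>T\<close>
  with \<open>p = M\<^sup>T q\<close>, since \<open>|M - q p\<^sup>T|\<^sup>2 = |M|\<^sup>2 - 2 |p|\<^sup>2 + |q|\<^sup>2 |p|\<^sup>2\<close>.\<close>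

lemma
  fixes M :: "nat \<Rightarrow> nat \<Rightarrow> nat \<Rightarrow> real" and q p :: "nat \<Rightarrow> nat \<Rightarrow> real" and a b :: nat
  assumes nq: "(\<lambda>t. \<Sum>i<a. (q t i)\<^sup>2) \<longlonglongrightarrow> 1"
    and nM: "(\<lambda>t. \<Sum>i<a. \<Sum>j<b. (M t i j)\<^sup>2) \<longlonglongrightarrow> 1"
    and MM: "\<And>i i'. i < a \<Longrightarrow> i' < a \<Longrightarrow> (\<lambda>t. (\<Sum>j<b. M t i j * M t i' j) - q t i * q t i') \<longlonglongrightarrow> 0"
    and p: "\<And>t j. j < b \<Longrightarrow> p t j = (\<Sum>i<a. q t i * M t i j)"
  shows rank_one_limit_norm: "(\<lambda>t. \<Sum>j<b. (p t j)\<^sup>2) \<longlonglongrightarrow> 1"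
    and rank_one_limit_entry: "i < a \<Longrightarrow> j < b \<Longrightarrow> (\<lambda>t. M t i j - q t i * p t j) \<longlonglongrightarrow> 0"
    and rank_one_limit_gram: "j < b \<Longrightarrow> j' < b \<Longrightarrow> (\<lambda>t. (\<Sum>i<a. M t i j * M t i j') - p t j * p t j') \<longlonglongrightarrow> 0"
proof -
  have Bq: "Bseq (\<lambda>t. q t i)" if "i < a" for i
    using Bseq_if_sum_squares_tendsto[OF nq] that by simp
  \<comment> \<open>The squared norm of p is the quadratic form of M M^T at q. Replacing M M^T by q
    q^T turns it into the fourth power of the norm of q, which tends to 1.\<close>
  have pp: "(\<Sum>j<b. (p t j)\<^sup>2) = (\<Sum>i<a. \<Sum>i'<a. q t i * q t i' * (\<Sum>j<b. M t i j * M t i' j))" for t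
  proof -
    have "(\<Sum>j<b. (p t j)\<^sup>2) = (\<Sum>j<b. \<Sum>i<a. \<Sum>i'<a. q t i * q t i' * (M t i j * M t i' j))"
      by (simp add: p power2_eq_square sum_product mult_ac)
    also have "\<dots> = (\<Sum>i<a. \<Sum>j<b. \<Sum>i'<a. q t i * q t i' * (M t i j * M t i' j))"
      by (rule sum.swap)
    also have "\<dots> = (\<Sum>i<a. \<Sum>i'<a. \<Sum>j<b. q t i * q t i' * (M t i j * M t i' j))"
      by (intro sum.cong refl sum.swap)
    finally show ?thesis by (simp add: sum_distrib_left)
  qed
  have qq: "(\<Sum>i<a. (q t i)\<^sup>2) * (\<Sum>i<a. (q t i)\<^sup>2) = (\<Sum>i<a. \<Sum>i'<a. q t i * q t i' * (q t i * q t i'))" for t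
    by (simp add: sum_product power2_eq_square mult_ac)
  have "(\<lambda>t. \<Sum>i<a. \<Sum>i'<a. q t i * q t i' * ((\<Sum>j<b. M t i j * M t i' j) - q t i * q t i')) \<longlonglongrightarrow> 0"
    by (intro tendsto_null_sum tendsto_zero_Bseq_mult Bseq_mult Bq MM) auto
  then have "(\<lambda>t. (\<Sum>j<b. (p t j)\<^sup>2) - (\<Sum>i<a. (q t i)\<^sup>2) * (\<Sum>i<a. (q t i)\<^sup>2)) \<longlonglongrightarrow> 0"
    by (simp add: pp qq right_diff_distrib sum_subtractf)
  from tendsto_add[OF this tendsto_mult[OF nq nq]]
  show np: "(\<lambda>t. \<Sum>j<b. (p t j)\<^sup>2) \<longlonglongrightarrow> 1" by simp
  have Bp: "Bseq (\<lambda>t. p t j)" if "j < b" for j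
    using Bseq_if_sum_squares_tendsto[OF np] that by simp
  have eq: "(\<Sum>i<a. \<Sum>j<b. (M t i j - q t i * p t j)\<^sup>2)
    = (\<Sum>i<a. \<Sum>j<b. (M t i j)\<^sup>2) - 2 * (\<Sum>j<b. (p t j)\<^sup>2) + (\<Sum>i<a. (q t i)\<^sup>2) * (\<Sum>j<b. (p t j)\<^sup>2)" for t
  proof -
    have "(\<Sum>i<a. \<Sum>j<b. (M t i j - q t i * p t j)\<^sup>2)
      = (\<Sum>i<a. \<Sum>j<b. (M t i j)\<^sup>2) - 2 * (\<Sum>i<a. \<Sum>j<b. q t i * M t i j * p t j)
        + (\<Sum>i<a. \<Sum>j<b. (q t i)\<^sup>2 * (p t j)\<^sup>2)"
      by (simp add: power2_diff power_mult_distrib sum.distrib sum_subtractf sum_distrib_left mult_ac)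
    also have "(\<Sum>i<a. \<Sum>j<b. q t i * M t i j * p t j) = (\<Sum>j<b. \<Sum>i<a. q t i * M t i j * p t j)"
      by (rule sum.swap)
    also have "\<dots> = (\<Sum>j<b. (p t j)\<^sup>2)"
      by (simp add: p power2_eq_square sum_distrib_right)
    finally show ?thesis by (simp add: sum_product)
  qed
  have "(\<lambda>t. \<Sum>i<a. \<Sum>j<b. (M t i j - q t i * p t j)\<^sup>2) \<longlonglongrightarrow> 1 - 2 * 1 + 1 * 1"
    unfolding eq by (intro tendsto_intros nq np nM)
  then have E: "(\<lambda>t. \<Sum>i<a. \<Sum>j<b. (M t i j - q t i * p t j)\<^sup>2) \<longlonglongrightarrow> 0" by simp
  show ent: "(\<lambda>t. M t i j - q t i * p t j) \<longlonglongrightarrow> 0" if "i < a" "j < b" for i j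
  proof (rule tendsto_zero_if_square, rule tendsto_sandwich[OF _ _ tendsto_const E])
    have "(M t i j - q t i * p t j)\<^sup>2 \<le> (\<Sum>j<b. (M t i j - q t i * p t j)\<^sup>2)" for t
      using that member_le_sum[of j "{..<b}" "\<lambda>j. (M t i j - q t i * p t j)\<^sup>2"] by auto
    also have "\<dots> t \<le> (\<Sum>i<a. \<Sum>j<b. (M t i j - q t i * p t j)\<^sup>2)" for t
      using that by (intro member_le_sum[of i "{..<a}" "\<lambda>i. \<Sum>j<b. (M t i j - q t i * p t j)\<^sup>2"])
        (auto intro: sum_nonneg)
    finally show "\<forall>\<^sub>F t in sequentially. (M t i j - q t i * p t j)\<^sup>2
        \<le> (\<Sum>i<a. \<Sum>j<b. (M t i j - q t i * p t j)\<^sup>2)" by simp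
  qed simp
  show "(\<lambda>t. (\<Sum>i<a. M t i j * M t i j') - p t j * p t j') \<longlonglongrightarrow> 0" if j: "j < b" "j' < b"
  proof -
    have BM: "Bseq (\<lambda>t. M t i j)" if "i < a" for i
    proof -
      have "Bseq (\<lambda>t. (M t i j - q t i * p t j) + q t i * p t j)"
        by (intro Bseq_plus Bseq_mult Bq Bp that j convergent_imp_Bseq convergentI[OF ent])
      then show ?thesis by simp
    qed
    \<comment> \<open>M_ij M_ij' equals M_ij (M_ij' - q_i p_j') + q_i p_j' (M_ij - q_i p_j) + q_i^2
      p_j p_j'. The first two terms vanish in the limit, and the sum of the q_i^2 tends to
      1.\<close>
    have "(\<lambda>t. \<Sum>i<a. M t i j * (M t i j' - q t i * p t j') + (q t i * p t j') * (M t i j - q t i * p t j)) \<longlonglongrightarrow> 0"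
      using j by (intro tendsto_null_sum tendsto_add_zero tendsto_zero_Bseq_mult Bseq_mult ent BM Bq Bp) auto
    moreover have "(\<lambda>t. (p t j * p t j') * ((\<Sum>i<a. (q t i)\<^sup>2) - 1)) \<longlonglongrightarrow> 0"
      using j by (intro tendsto_zero_Bseq_mult Bseq_mult Bp LIM_zero nq)
    ultimately have "(\<lambda>t. (\<Sum>i<a. M t i j * (M t i j' - q t i * p t j') + (q t i * p t j') * (M t i j - q t i * p t j))
        + (p t j * p t j') * ((\<Sum>i<a. (q t i)\<^sup>2) - 1)) \<longlonglongrightarrow> 0"
      by (rule tendsto_add_zero)
    also have "(\<lambda>t. (\<Sum>i<a. M t i j * (M t i j' - q t i * p t j') + (q t i * p t j') * (M t i j - q t i * p t j))
        + (p t j * p t j') * ((\<Sum>i<a. (q t i)\<^sup>2) - 1)) = (\<lambda>t. (\<Sum>i<a. M t i j * M t i j') - p t j * p t j')"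
      by (simp add: fun_eq_iff algebra_simps sum.distrib sum_subtractf sum_distrib_left sum_distrib_right power2_eq_square)
    finally show ?thesis by simp
  qed
qed

text \<open>Since M is close to q p^T, the squared norm of M u is close to the square of the inner
  product of p and u for bounded u. Testing the maximality of v against u = p bounds that square at
  v from below asymptotically, and Cauchy-Schwarz bounds it from above.\<close>

lemma right_singular_limit:
  fixes M :: "nat \<Rightarrow> nat \<Rightarrow> nat \<Rightarrow> real" and q p v :: "nat \<Rightarrow> nat \<Rightarrow> real" and a b :: nat
  assumes nq: "(\<lambda>t. \<Sum>i<a. (q t i)\<^sup>2) \<longlonglongrightarrow> 1"
    and np: "(\<lambda>t. \<Sum>j<b. (p t j)\<^sup>2) \<longlonglongrightarrow> 1"
    and M: "\<And>i j. i < a \<Longrightarrow> j < b \<Longrightarrow> (\<lambda>t. M t i j - q t i * p t j) \<longlonglongrightarrow> 0"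
    and v: "\<And>t. (\<Sum>j<b. (v t j)\<^sup>2) = 1"
    and max: "\<And>t u. (\<Sum>i<a. (\<Sum>j<b. M t i j * u j)\<^sup>2) \<le> (\<Sum>j<b. (u j)\<^sup>2) * (\<Sum>i<a. (\<Sum>j<b. M t i j * v t j)\<^sup>2)"
  shows "(\<lambda>t. \<bar>\<Sum>j<b. p t j * v t j\<bar>) \<longlonglongrightarrow> 1"
proof -
  have Bq: "Bseq (\<lambda>t. q t i)" if "i < a" for i
    using Bseq_if_sum_squares_tendsto[OF nq] that by simp
  have Bp: "Bseq (\<lambda>t. p t j)" if "j < b" for j
    using Bseq_if_sum_squares_tendsto[OF np] that by simp
  have img: "(\<lambda>t. (\<Sum>i<a. (\<Sum>j<b. M t i j * u t j)\<^sup>2) - (\<Sum>j<b. p t j * u t j)\<^sup>2) \<longlonglongrightarrow> 0"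
    if Bu: "\<And>j. j < b \<Longrightarrow> Bseq (\<lambda>t. u t j)" for u
  proof -
    define \<alpha> where "\<alpha> t = (\<Sum>j<b. p t j * u t j)" for t
    define e where "e t i = (\<Sum>j<b. u t j * (M t i j - q t i * p t j))" for t i
    have Ba: "Bseq \<alpha>"
      unfolding \<alpha>_def by (intro Bseq_sum Bseq_mult Bu Bp) auto
    have e: "(\<lambda>t. e t i) \<longlonglongrightarrow> 0" if "i < a" for i
      unfolding e_def using that by (intro tendsto_null_sum tendsto_zero_Bseq_mult Bu M) auto
    have eq: "(\<Sum>j<b. M t i j * u t j) = q t i * \<alpha> t + e t i" for t i
      by (simp add: e_def \<alpha>_def sum_distrib_left sum_subtractf algebra_simps)
    have "(\<lambda>t. \<Sum>i<a. (2 * (q t i * \<alpha> t)) * e t i + e t i * e t i) \<longlonglongrightarrow> 0"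
      by (intro tendsto_null_sum tendsto_add_zero tendsto_zero_Bseq_mult Bseq_mult tendsto_mult_zero e Bq Ba Bfun_const) auto
    moreover have "(\<lambda>t. (\<alpha> t * \<alpha> t) * ((\<Sum>i<a. (q t i)\<^sup>2) - 1)) \<longlonglongrightarrow> 0"
      by (intro tendsto_zero_Bseq_mult Bseq_mult Ba LIM_zero nq)
    ultimately have "(\<lambda>t. (\<Sum>i<a. (2 * (q t i * \<alpha> t)) * e t i + e t i * e t i) + (\<alpha> t * \<alpha> t) * ((\<Sum>i<a. (q t i)\<^sup>2) - 1)) \<longlonglongrightarrow> 0"
      by (rule tendsto_add_zero)
    also have "(\<lambda>t. (\<Sum>i<a. (2 * (q t i * \<alpha> t)) * e t i + e t i * e t i) + (\<alpha> t * \<alpha> t) * ((\<Sum>i<a. (q t i)\<^sup>2) - 1))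
      = (\<lambda>t. (\<Sum>i<a. (q t i * \<alpha> t + e t i)\<^sup>2) - (\<alpha> t)\<^sup>2)"
      by (simp add: fun_eq_iff power2_eq_square algebra_simps sum.distrib sum_distrib_left)
    finally show ?thesis by (simp add: eq \<alpha>_def)
  qed
  define P where "P t = (\<Sum>j<b. (p t j)\<^sup>2)" for t
  define \<alpha> where "\<alpha> t = (\<Sum>j<b. p t j * v t j)" for t
  define h where "h t = (\<Sum>i<a. (\<Sum>j<b. M t i j * v t j)\<^sup>2)" for t
  have P1: "P \<longlonglongrightarrow> 1" using np by (simp add: P_def[abs_def])
  have "Bseq (\<lambda>t. v t j)" if "j < b" for j
    using Bseq_if_sum_squares_tendsto[of v "{..<b}" 1] v that by simp
  then have "(\<lambda>t. h t - (\<alpha> t)\<^sup>2) \<longlonglongrightarrow> 0"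
    using img[of v] by (simp add: h_def \<alpha>_def)
  moreover have "(\<lambda>t. (\<Sum>i<a. (\<Sum>j<b. M t i j * p t j)\<^sup>2) - (P t)\<^sup>2) \<longlonglongrightarrow> 0"
    using img[of p] Bp by (simp add: P_def power2_eq_square)
  ultimately have low: "(\<lambda>t. ((\<Sum>i<a. (\<Sum>j<b. M t i j * p t j)\<^sup>2) - (P t)\<^sup>2) + (P t)\<^sup>2 - P t * (h t - (\<alpha> t)\<^sup>2))
      \<longlonglongrightarrow> 0 + 1\<^sup>2 - 1 * 0"
    by (intro tendsto_intros P1)
  have up: "(\<lambda>t. P t * P t) \<longlonglongrightarrow> 1" using tendsto_mult[OF P1 P1] by simp
  have "(\<lambda>t. P t * (\<alpha> t)\<^sup>2) \<longlonglongrightarrow> 1"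
  proof (rule tendsto_sandwich[OF _ _ _ up])
    show "(\<lambda>t. ((\<Sum>i<a. (\<Sum>j<b. M t i j * p t j)\<^sup>2) - (P t)\<^sup>2) + (P t)\<^sup>2 - P t * (h t - (\<alpha> t)\<^sup>2)) \<longlonglongrightarrow> 1"
      using low by simp
    have "(\<Sum>i<a. (\<Sum>j<b. M t i j * p t j)\<^sup>2) \<le> P t * h t" for t
      using max[of t "p t"] by (simp add: P_def h_def)
    then show "\<forall>\<^sub>F t in sequentially. (\<Sum>i<a. (\<Sum>j<b. M t i j * p t j)\<^sup>2) - (P t)\<^sup>2 + (P t)\<^sup>2 - P t * (h t - (\<alpha> t)\<^sup>2)
        \<le> P t * (\<alpha> t)\<^sup>2"
      by (simp add: algebra_simps)
    have "(\<alpha> t)\<^sup>2 \<le> P t" for t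
      using Cauchy_Schwarz_ineq_sum[of "p t" "v t" "{..<b}"] v[of t] by (simp add: \<alpha>_def P_def)
    then show "\<forall>\<^sub>F t in sequentially. P t * (\<alpha> t)\<^sup>2 \<le> P t * P t"
      by (intro always_eventually allI mult_left_mono) (auto simp: P_def intro: sum_nonneg)
  qed
  from tendsto_divide[OF this P1] have "(\<lambda>t. P t * (\<alpha> t)\<^sup>2 / P t) \<longlonglongrightarrow> 1" by simp
  moreover have "\<forall>\<^sub>F t in sequentially. P t * (\<alpha> t)\<^sup>2 / P t = (\<alpha> t)\<^sup>2"
    using order_tendstoD(1)[OF P1 zero_less_one] by eventually_elim auto
  ultimately have "(\<lambda>t. (\<alpha> t)\<^sup>2) \<longlonglongrightarrow> 1"
    by (rule Lim_transform_eventually)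
  from tendsto_real_sqrt[OF this] show ?thesis by (simp add: \<alpha>_def)
qed

text \<open>Downward induction on the layer. The last layer is a single row of asymptotically unit
  norm, with upper product 1, which settles the base case.\<close>

lemma balanced_net_limit:
  assumes dims_L: "dims L = 1" and k: "1 \<le> k" "k \<le> L"
    and unit: "\<And>k. k \<in> {1..L} \<Longrightarrow> (\<lambda>t. (fnorm dims (N t) k)\<^sup>2) \<longlonglongrightarrow> 1"
    and bal: "\<And>k i j. 1 \<le> k \<Longrightarrow> k < L \<Longrightarrow> i < dims k \<Longrightarrow> j < dims k \<Longrightarrow> (\<lambda>t. imbalance dims (N t) k i j) \<longlonglongrightarrow> 0"
  shows "(\<lambda>t. \<Sum>i<dims k. (lft L dims (N t) k i)\<^sup>2) \<longlonglongrightarrow> 1"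
    and "\<And>i i'. i < dims k \<Longrightarrow> i' < dims k \<Longrightarrow>
      (\<lambda>t. (\<Sum>j<dims (k - 1). N t k i j * N t k i' j) - lft L dims (N t) k i * lft L dims (N t) k i') \<longlonglongrightarrow> 0"
proof -
  have "(\<lambda>t. \<Sum>i<dims k. (lft L dims (N t) k i)\<^sup>2) \<longlonglongrightarrow> 1 \<and>
    (\<forall>i i'. i < dims k \<longrightarrow> i' < dims k \<longrightarrow>
      (\<lambda>t. (\<Sum>j<dims (k - 1). N t k i j * N t k i' j) - lft L dims (N t) k i * lft L dims (N t) k i') \<longlonglongrightarrow> 0)"
    using k(2,1)
  proof (induction k rule: inc_induct)
    case base
    then have "(\<lambda>t. (\<Sum>j<dims (L - 1). (N t L 0 j)\<^sup>2) - 1) \<longlonglongrightarrow> 0"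
      using unit[of L] dims_L by (intro LIM_zero) (simp add: fnorm_sq)
    then show ?case using dims_L by (simp add: power2_eq_square)
  next
    case (step k)
    let ?p = "\<lambda>k t. lft L dims (N t) k"
    have IH1: "(\<lambda>t. \<Sum>i<dims (Suc k). (?p (Suc k) t i)\<^sup>2) \<longlonglongrightarrow> 1"
      and IH2: "\<And>i i'. i < dims (Suc k) \<Longrightarrow> i' < dims (Suc k) \<Longrightarrow>
      (\<lambda>t. (\<Sum>j<dims k. N t (Suc k) i j * N t (Suc k) i' j) - ?p (Suc k) t i * ?p (Suc k) t i') \<longlonglongrightarrow> 0"
      using step.IH by auto
    have un: "(\<lambda>t. \<Sum>i<dims (Suc k). \<Sum>j<dims k. (N t (Suc k) i j)\<^sup>2) \<longlonglongrightarrow> 1"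
      using unit[of "Suc k"] step.hyps by (simp add: fnorm_sq)
    have p: "?p k t j = (\<Sum>i<dims (Suc k). ?p (Suc k) t i * N t (Suc k) i j)" for t j
      using step.hyps by (rule_tac lft_step)
    note r1 = IH1 un IH2 p
    \<comment> \<open>Vanishing imbalance converts the Gram matrix of the columns of layer k + 1,
      known from \<open>rank_one_limit_gram\<close>, into that of the rows of layer k.\<close>
    have "(\<lambda>t. (\<Sum>j<dims (k - 1). N t k i j * N t k i' j) - ?p k t i * ?p k t i') \<longlonglongrightarrow> 0"
      if "i < dims k" "i' < dims k" for i i'
      using tendsto_diff[OF rank_one_limit_gram[OF r1 that] bal[OF _ _ that]] step
      by (simp add: imbalance_def)
    then show ?case using rank_one_limit_norm[OF r1] by blast
  qed
  then show "(\<lambda>t. \<Sum>i<dims k. (lft L dims (N t) k i)\<^sup>2) \<longlonglongrightarrow> 1"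
    and "\<And>i i'. i < dims k \<Longrightarrow> i' < dims k \<Longrightarrow>
      (\<lambda>t. (\<Sum>j<dims (k - 1). N t k i j * N t k i' j) - lft L dims (N t) k i * lft L dims (N t) k i') \<longlonglongrightarrow> 0"
    by auto
qed

text \<open>Maximality will be tested at products of normalised layers, which have unit norm only in
  the limit; hence the version for vectors of any length.\<close>

lemma first_right_sing_vec_homogeneous:
  assumes "first_right_sing_vec dims V v"
  shows "(\<Sum>i<dims 1. (\<Sum>j<dims 0. V 1 i j * u j)\<^sup>2)
    \<le> (\<Sum>j<dims 0. (u j)\<^sup>2) * (\<Sum>i<dims 1. (\<Sum>j<dims 0. V 1 i j * v j)\<^sup>2)"
proof (cases "(\<Sum>j<dims 0. (u j)\<^sup>2) = 0")
  case True
  then have "u j = 0" if "j < dims 0" for j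
    using that by (simp add: sum_nonneg_eq_0_iff)
  then show ?thesis by simp
next
  case False
  define s where "s = (\<Sum>j<dims 0. (u j)\<^sup>2)"
  have s: "0 < s" using False by (simp add: s_def sum_nonneg less_le)
  have "(\<Sum>j<dims 0. (u j / sqrt s)\<^sup>2) = 1"
    using s by (simp add: power_divide flip: sum_divide_distrib) (simp add: s_def)
  then have "(\<Sum>i<dims 1. (\<Sum>j<dims 0. V 1 i j * (u j / sqrt s))\<^sup>2) \<le> (\<Sum>i<dims 1. (\<Sum>j<dims 0. V 1 i j * v j)\<^sup>2)"
    using assms[unfolded first_right_sing_vec_def, THEN conjunct2, THEN spec, of "\<lambda>j. u j / sqrt s"] by (rule rev_mp)
  moreover have "(\<Sum>i<dims 1. (\<Sum>j<dims 0. V 1 i j * (u j / sqrt s))\<^sup>2) = (\<Sum>i<dims 1. (\<Sum>j<dims 0. V 1 i j * u j)\<^sup>2) / s"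
    using s by (simp add: power_divide flip: sum_divide_distrib)
  ultimately show ?thesis
    unfolding s_def[symmetric] using s by (simp only: pos_divide_le_eq mult.commute)
qed

subsection \<open>Gradient descent\<close>

locale gd_linear_net =
  fixes L n :: nat and dims :: "nat \<Rightarrow> nat"
    and x :: "nat \<Rightarrow> nat \<Rightarrow> real" and y :: "nat \<Rightarrow> real"
    and loss loss' :: "real \<Rightarrow> real" and \<beta> G :: real
    and W :: "nat \<Rightarrow> net" and \<eta> Rad :: "nat \<Rightarrow> real"
  assumes L: "L \<ge> 2"
    and dims_L: "dims L = 1"
    and x_norm: "\<forall>i<n. (\<Sum>j<dims 0. (x i j)\<^sup>2) \<le> 1"
    and y_lab: "\<forall>i<n. y i = -1 \<or> y i = 1"
    and separable: "\<exists>u. \<forall>i<n. (\<Sum>j<dims 0. u j * (y i * x i j)) > 0"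
    and loss_deriv: "\<forall>s. (loss has_real_derivative loss' s) (at s)"
    and loss'_cont: "continuous_on UNIV loss'"
    and loss'_neg: "\<forall>s. loss' s < 0"
    and loss_bot: "filterlim loss at_top at_bot"
    and loss_top: "(loss \<longlongrightarrow> 0) at_top"
    and grad0: "\<exists>k\<in>{1..L}. \<exists>i<dims k. \<exists>j<dims (k - 1). grad_risk loss n x y L dims (W 0) k i j \<noteq> 0"
    and risk0: "risk loss n x y L dims (W 0) \<le> loss 0"
    and lip: "\<forall>a b. \<bar>loss' a - loss' b\<bar> \<le> \<beta> * \<bar>a - b\<bar>"
    and bnd: "\<forall>s. \<bar>loss' s\<bar> \<le> G"
    and step: "\<forall>t. \<eta> t = min (1 / (2 * real L ^ 2 * Rad t ^ (2 * L - 2) * (\<beta> + G))) 1"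
    and radii: "\<forall>t. in_ball L dims (Rad t - 1) (W t)"
    and radii_const: "\<forall>t. in_ball L dims (Rad t - 1) (W (Suc t)) \<longrightarrow> Rad (Suc t) = Rad t"
    and gd: "\<forall>t k i j. W (Suc t) k i j = W t k i j - \<eta> t * grad_risk loss n x y L dims (W t) k i j"
begin

abbreviation "Risk \<equiv> risk loss n x y L dims"
abbreviation "Grad \<equiv> grad_risk loss n x y L dims"

definition z :: "nat \<Rightarrow> nat \<Rightarrow> real" where "z i j = y i * x i j"

text \<open>The gradient of the risk with respect to the product vector.\<close>

definition gvec :: "net \<Rightarrow> nat \<Rightarrow> real" where
  "gvec V j = (\<Sum>i<n. (loss' (fwd dims V (z i) L 0) / real n) * z i j)"

definition gradsq :: "net \<Rightarrow> real" where
  "gradsq V = (\<Sum>k=1..L. (fnorm dims (Grad V) k)\<^sup>2)"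

section \<open>Elementary facts on the loss, and the gradient of the risk\<close>

lemma risk_eq: "Risk V = (1 / real n) * (\<Sum>i<n. loss (fwd dims V (z i) L 0))"
  unfolding risk_def by (simp add: wprod_inner[of dims L, OF dims_L] flip: z_def)

lemma loss_strict_antimono: "s < t \<Longrightarrow> loss t < loss s"
  using loss_deriv loss'_neg DERIV_neg_imp_decreasing[of s t loss] by blast

lemma loss_antimono: "s \<le> t \<Longrightarrow> loss t \<le> loss s"
  using loss_strict_antimono[of s t] by (cases "s = t") auto

lemma loss_pos: "0 < loss s"
proof -
  have "\<forall>\<^sub>F t in at_top. loss t \<le> loss (s + 1)"
    using eventually_ge_at_top[of "s + 1"] by eventually_elim (rule loss_antimono)
  then have "0 \<le> loss (s + 1)"
    using tendsto_upperbound[OF loss_top] by simp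
  then show ?thesis using loss_strict_antimono[of s "s + 1"] by simp
qed

lemma beta_nonneg: "0 \<le> \<beta>"
  using lip[rule_format, of 1 0] by (auto intro: order_trans[OF abs_ge_zero])

lemma G_pos: "0 < G"
  using bnd[rule_format, of 0] loss'_neg[rule_format, of 0] by linarith

text \<open>Without samples the risk would be constant, against the nonzero initial
  gradient.\<close>

lemma n_pos: "0 < n"
proof (rule ccontr)
  assume "\<not> 0 < n"
  then have "Risk V = 0" for V by (simp add: risk_def)
  then show False using grad0 by (simp add: grad_risk_def)
qed

lemma z_norm: "i < n \<Longrightarrow> L2_set (z i) {..<dims 0} \<le> 1"
  using x_norm y_lab by (auto simp: L2_set_def z_def power_mult_distrib)

text \<open>The output is affine in a single entry, with slope an entry of the upper product times a
  coordinate of the lower output. The chain rule and linearity in the input then give the formula;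
  in particular the gradient of each layer has rank one.\<close>

lemma grad_risk_eq:
  assumes "k \<in> {1..L}" "i < dims k" "j < dims (k - 1)"
  shows "Grad V k i j = lft L dims V k i * fwd dims V (gvec V) (k - 1) j"
proof -
  define V' where "V' s = V(k := (V k)(i := (V k i)(j := s)))" for s
  define c where "c z = lft L dims V k i * fwd dims V z (k - 1) j" for z
  obtain k' where k': "k = Suc k'" using assms by (cases k) auto
  have V'0: "V' (V k i j) = V" by (simp add: V'_def)
  have affine: "fwd dims (V' s) z L 0 = fwd dims V z L 0 + (s - V k i j) * c z" for s z
  proof -
    have l: "lft L dims (V' s) k a = lft L dims V k a" for a
      using assms by (intro lft_cong) (auto simp: V'_def)
    have u: "fwd dims (V' s) z k' m = fwd dims V z k' m" for m
      by (intro fwd_cong) (auto simp: V'_def k')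
    have e: "V' s k a m = V k a m + (if m = j then if a = i then s - V k i j else 0 else 0)" for a m
      by (auto simp: V'_def)
    have "fwd dims (V' s) z k a = fwd dims V z k a + (if a = i then (s - V k i j) * fwd dims V z k' j else 0)" for a
      using assms e by (simp add: k' u distrib_right sum.distrib if_distrib[of "\<lambda>h. h * _"] cong: if_cong)
    then have "fwd dims (V' s) z L 0 = (\<Sum>a<dims k. lft L dims V k a *
        (fwd dims V z k a + (if a = i then (s - V k i j) * fwd dims V z k' j else 0)))"
      using lft_fwd[of dims L k "V' s" z] dims_L assms by (simp add: l)
    also have "\<dots> = (\<Sum>a<dims k. lft L dims V k a * fwd dims V z k a)
        + lft L dims V k i * ((s - V k i j) * fwd dims V z k' j)"
      using assms by (simp add: distrib_left sum.distrib if_distrib[of "\<lambda>h. _ * h"] cong: if_cong)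
    finally show ?thesis
      using lft_fwd[of dims L k V z] dims_L assms by (simp add: c_def k' algebra_simps)
  qed
  have "((\<lambda>s. loss (fwd dims (V' s) (z a) L 0)) has_real_derivative
      loss' (fwd dims V (z a) L 0) * c (z a)) (at (V k i j))" for a
  proof (rule DERIV_chain2[where f = loss and g = "\<lambda>s. fwd dims (V' s) (z a) L 0"])
    show "(loss has_real_derivative loss' (fwd dims V (z a) L 0)) (at (fwd dims (V' (V k i j)) (z a) L 0))"
      using loss_deriv by (simp add: V'0)
    show "((\<lambda>s. fwd dims (V' s) (z a) L 0) has_real_derivative c (z a)) (at (V k i j))"
      unfolding affine by (auto intro!: derivative_eq_intros)
  qed
  then have "((\<lambda>s. Risk (V' s)) has_real_derivative
      (1 / real n) * (\<Sum>a<n. loss' (fwd dims V (z a) L 0) * c (z a))) (at (V k i j))"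
    unfolding risk_eq by (intro DERIV_cmult DERIV_sum)
  then have "Grad V k i j = (1 / real n) * (\<Sum>a<n. loss' (fwd dims V (z a) L 0) * c (z a))"
    unfolding grad_risk_def V'_def by (rule DERIV_imp_deriv)
  also have "\<dots> = lft L dims V k i * fwd dims V (gvec V) (k - 1) j"
    unfolding gvec_def[abs_def] fwd_sum c_def by (simp add: sum_distrib_left mult_ac)
  finally show ?thesis .
qed

lemma gvec_norm: "L2_set (gvec V) {..<dims 0} \<le> G"
proof -
  have "L2_set (gvec V) {..<dims 0}
      \<le> (\<Sum>i<n. L2_set (\<lambda>j. (loss' (fwd dims V (z i) L 0) / real n) * z i j) {..<dims 0})"
    unfolding gvec_def[abs_def] by (rule L2_set_sum_le)
  also have "\<dots> \<le> (\<Sum>i<n. G / real n * 1)"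
    unfolding L2_set_cmult using bnd G_pos
    by (intro sum_mono mult_mono) (auto intro!: divide_right_mono z_norm)
  also have "\<dots> = G" using n_pos by simp
  finally show ?thesis .
qed

lemma fnorm_grad:
  assumes "k \<in> {1..L}"
  shows "fnorm dims (Grad V) k = L2_set (lft L dims V k) {..<dims k} * L2_set (fwd dims V (gvec V) (k - 1)) {..<dims (k - 1)}"
  using assms by (intro fnorm_rank_one grad_risk_eq)

text \<open>The layers above and below contribute L - 1 factors R in all. The exponent is raised to
  2 L - 2 to match the one in the step size.\<close>

lemma fnorm_grad_le:
  assumes "k \<in> {1..L}" "in_ball L dims R V" "1 \<le> R"
  shows "fnorm dims (Grad V) k \<le> R ^ (2 * L - 2) * G"
proof -
  have "L2_set (fwd dims V (gvec V) (k - 1)) {..<dims (k - 1)} \<le> R ^ (k - 1) * L2_set (gvec V) {..<dims 0}"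
    using assms by (intro L2_set_fwd_le) auto
  also have "\<dots> \<le> R ^ (k - 1) * G"
    using gvec_norm assms by (intro mult_left_mono) auto
  finally have "fnorm dims (Grad V) k \<le> R ^ (L - k) * (R ^ (k - 1) * G)"
    unfolding fnorm_grad[OF assms(1)] using assms dims_L G_pos
    by (intro mult_mono L2_set_lft_le) auto
  also have "\<dots> = R ^ (L - k + (k - 1)) * G"
    by (simp add: power_add)
  also have "\<dots> \<le> R ^ (2 * L - 2) * G"
    using assms G_pos by (intro mult_right_mono power_increasing) auto
  finally show ?thesis .
qed

lemma gradsq_nonneg: "0 \<le> gradsq V"
  by (simp add: gradsq_def sum_nonneg)

lemma fnorm_grad_sq_le: "k \<in> {1..L} \<Longrightarrow> (fnorm dims (Grad V) k)\<^sup>2 \<le> gradsq V"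
  unfolding gradsq_def by (intro member_le_sum) auto

section \<open>Sufficient decrease of the risk\<close>

lemma loss_mvt: "\<exists>c. \<bar>c - a\<bar> \<le> \<bar>b - a\<bar> \<and> loss b - loss a = loss' c * (b - a)"
proof (cases a b rule: linorder_cases)
  case less
  then obtain c where "a < c" "c < b" "loss b - loss a = (b - a) * loss' c"
    using MVT2[OF less, of loss loss'] loss_deriv by auto
  then show ?thesis by (intro exI[of _ c]) auto
next
  case greater
  then obtain c where "b < c" "c < a" "loss a - loss b = (a - b) * loss' c"
    using MVT2[OF greater, of loss loss'] loss_deriv by auto
  then show ?thesis by (intro exI[of _ c]) (auto simp: algebra_simps)
qed auto

text \<open>The mean value theorem yields the coefficient \<beta> where integration would yield half
  of it; the factor 2 in the step size bound leaves room for this.\<close>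

lemma loss_quadratic_upper: "loss b \<le> loss a + loss' a * (b - a) + \<beta> * (b - a)\<^sup>2"
proof -
  obtain c where c: "\<bar>c - a\<bar> \<le> \<bar>b - a\<bar>" "loss b - loss a = loss' c * (b - a)"
    using loss_mvt by blast
  have "(loss' c - loss' a) * (b - a) \<le> \<bar>loss' c - loss' a\<bar> * \<bar>b - a\<bar>"
    by (metis abs_ge_self abs_mult)
  also have "\<dots> \<le> (\<beta> * \<bar>c - a\<bar>) * \<bar>b - a\<bar>"
    using lip by (intro mult_right_mono) auto
  also have "\<dots> \<le> (\<beta> * \<bar>b - a\<bar>) * \<bar>b - a\<bar>"
    using c beta_nonneg by (intro mult_right_mono mult_left_mono) auto
  also have "\<dots> = \<beta> * (b - a)\<^sup>2" by (simp add: power2_eq_square mult.assoc)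
  finally show ?thesis using c(2) by (simp add: algebra_simps)
qed

text \<open>There are two second order errors: the curvature of the loss acting on the first order
  change of the output, with factor \<beta>, and the nonlinearity of the layer product, multiplied
  by the slope of the loss, with factor \<open>G\<close>.\<close>

lemma risk_taylor_upper:
  assumes W: "in_ball L dims R U" and V: "in_ball L dims R V" and R: "1 \<le> R"
    and VW: "\<And>k i j. V k i j = U k i j + D k i j"
    and D: "\<And>k. 1 \<le> k \<Longrightarrow> k \<le> L \<Longrightarrow> fnorm dims D k \<le> \<delta>"
  shows "Risk V \<le> Risk U + lin dims U D (gvec U) L 0 + real L ^ 2 * R ^ (2 * L - 2) * (\<beta> + G) * \<delta>\<^sup>2"
proof -
  let ?E = "real L ^ 2 * R ^ (2 * L - 2) * (\<beta> + G) * \<delta>\<^sup>2"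
  let ?f = "\<lambda>V i. fwd dims V (z i) L 0"
  let ?l = "\<lambda>i. lin dims U D (z i) L 0"
  have pw: "R ^ (L - 1) * R ^ (L - 1) = R ^ (2 * L - 2)"
    using L by (metis power_add diff_mult_distrib2 mult_2 nat_mult_1_right)
  have \<delta>: "0 \<le> \<delta>" using D[of 1] fnorm_nonneg[of dims D 1] L by linarith
  have pt: "loss (?f V i) \<le> loss (?f U i) + loss' (?f U i) * ?l i + ?E" if i: "i < n" for i
  proof -
    let ?e = "?f V i - ?f U i"
    have "\<bar>?e\<bar> \<le> real L * R ^ (L - 1) * \<delta>"
      using L2_set_fwd_diff_le[OF W V VW D z_norm[OF i], of L] dims_L by (simp add: L2_set_def)
    then have "?e\<^sup>2 \<le> (real L * R ^ (L - 1) * \<delta>)\<^sup>2"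
      by (rule abs_le_square_iff[THEN iffD1, OF order_trans[OF _ abs_ge_self]])
    also have "\<dots> = real L ^ 2 * R ^ (2 * L - 2) * \<delta>\<^sup>2"
      by (simp only: power_mult_distrib power2_eq_square[of "R ^ (L - 1)"] pw)
    finally have e: "\<beta> * ?e\<^sup>2 \<le> \<beta> * (real L ^ 2 * R ^ (2 * L - 2) * \<delta>\<^sup>2)"
      using beta_nonneg by (rule mult_left_mono)
    have "\<bar>?e - ?l i\<bar> \<le> (real L)\<^sup>2 * R ^ (L - 1) * \<delta>\<^sup>2"
      using L2_set_fwd_taylor_le[OF W V R VW D z_norm[OF i], of L] dims_L by (simp add: L2_set_def)
    also have "\<dots> \<le> (real L)\<^sup>2 * R ^ (2 * L - 2) * \<delta>\<^sup>2"
      using R by (intro mult_right_mono mult_left_mono power_increasing) auto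
    finally have r: "\<bar>?e - ?l i\<bar> \<le> (real L)\<^sup>2 * R ^ (2 * L - 2) * \<delta>\<^sup>2" .
    have "loss' (?f U i) * (?e - ?l i) \<le> \<bar>loss' (?f U i)\<bar> * \<bar>?e - ?l i\<bar>"
      by (metis abs_ge_self abs_mult)
    also have "\<dots> \<le> G * ((real L)\<^sup>2 * R ^ (2 * L - 2) * \<delta>\<^sup>2)"
      using bnd r G_pos by (intro mult_mono) auto
    finally show ?thesis
      using loss_quadratic_upper[of "?f V i" "?f U i"] e by (simp add: algebra_simps)
  qed
  have "Risk V \<le> (1 / real n) * (\<Sum>i<n. loss (?f U i) + loss' (?f U i) * ?l i + ?E)"
    unfolding risk_eq by (intro mult_left_mono sum_mono pt) auto
  also have "\<dots> = Risk U + (\<Sum>i<n. (loss' (?f U i) / real n) * ?l i) + ?E"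
    using n_pos by (simp add: risk_eq sum.distrib sum_divide_distrib add_divide_distrib)
  also have "(\<Sum>i<n. (loss' (?f U i) / real n) * ?l i) = lin dims U D (gvec U) L 0"
    unfolding gvec_def[abs_def] lin_sum ..
  finally show ?thesis .
qed

lemma Rad_ge_1: "1 \<le> Rad t"
  using radii in_ball_nonneg[of L dims "Rad t - 1" "W t"] L by auto

lemma smooth_pos: "0 < real L ^ 2 * Rad t ^ (2 * L - 2) * (\<beta> + G)"
  using Rad_ge_1[of t] L beta_nonneg G_pos by (intro mult_pos_pos) auto

lemma eta_pos: "0 < \<eta> t"
  using step smooth_pos[of t] by (simp add: mult.assoc)

lemma eta_le_1: "\<eta> t \<le> 1"
  using step by simp

lemma eta_smooth: "\<eta> t * (real L ^ 2 * Rad t ^ (2 * L - 2) * (\<beta> + G)) \<le> 1 / 2"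
proof -
  let ?E = "real L ^ 2 * Rad t ^ (2 * L - 2) * (\<beta> + G)"
  have "\<eta> t \<le> 1 / (2 * ?E)" using step by (simp add: mult.assoc)
  then show ?thesis
    using smooth_pos[of t] by (simp only: pos_le_divide_eq[of "2 * ?E"] mult_pos_pos zero_less_numeral)
qed

text \<open>The linear term of the expansion is minus \<eta> times the squared gradient norm, and by
  \<open>eta_smooth\<close> the quadratic term cancels at most half of it.\<close>

lemma descent: "Risk (W (Suc t)) \<le> Risk (W t) - \<eta> t / 2 * gradsq (W t)"
proof -
  let ?U = "W t" and ?R = "Rad t"
  let ?E = "real L ^ 2 * ?R ^ (2 * L - 2) * (\<beta> + G)"
  define D where "D k i j = - \<eta> t * Grad ?U k i j" for k i j
  note R = Rad_ge_1[of t]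
  have U: "in_ball L dims (?R - 1) ?U" using radii by blast
  then have UR: "in_ball L dims ?R ?U" unfolding in_ball_def by force
  have VU: "W (Suc t) k i j = ?U k i j + D k i j" for k i j
    using gd by (simp add: D_def)
  have nD: "fnorm dims D k = \<eta> t * fnorm dims (Grad ?U) k" for k
    using eta_pos[of t]
    by (simp add: fnorm_def D_def power_mult_distrib real_sqrt_mult flip: sum_distrib_left)
  \<comment> \<open>No layer moves by more than 1, so a step from the ball of radius
    \<open>Rad t - 1\<close> ends in the ball of radius \<open>Rad t\<close>, where the expansion is
    valid.\<close>
  have "fnorm dims D k \<le> 1" if "k \<in> {1..L}" for k
  proof -
    have "fnorm dims (Grad ?U) k \<le> ?R ^ (2 * L - 2) * G"
      using that UR R by (rule fnorm_grad_le)
    also have "\<dots> \<le> real L ^ 2 * (?R ^ (2 * L - 2) * (\<beta> + G))"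
      using R L G_pos beta_nonneg
      by (intro order_trans[OF _ mult_right_mono[of 1 "real L ^ 2"]])
        (auto simp: mult_left_mono)
    finally have "fnorm dims D k \<le> \<eta> t * ?E"
      unfolding nD using eta_pos[of t] by (simp add: mult.assoc)
    then show ?thesis using eta_smooth[of t] by linarith
  qed
  then have VR: "in_ball L dims ?R (W (Suc t))"
    unfolding in_ball_def
    using fnorm_triangle[where V = "W (Suc t)" and W = ?U and D = D, OF VU] U
    by (smt (verit) in_ball_def)
  have DD: "fnorm dims D k \<le> \<eta> t * sqrt (gradsq ?U)" if "1 \<le> k" "k \<le> L" for k
    unfolding nD using that fnorm_grad_sq_le[of k ?U] eta_pos[of t]
    by (intro mult_left_mono real_le_rsqrt) auto
  have "Risk (W (Suc t)) \<le> Risk ?U + lin dims ?U D (gvec ?U) L 0 + ?E * (\<eta> t * sqrt (gradsq ?U))\<^sup>2"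
    by (rule risk_taylor_upper[OF UR VR R VU DD])
  also have "lin dims ?U D (gvec ?U) L 0 = - \<eta> t * gradsq ?U"
  proof -
    have "lft L dims ?U l i * D l i j * fwd dims ?U (gvec ?U) (l - 1) j = - \<eta> t * (Grad ?U l i j)\<^sup>2"
      if "l \<in> {1..L}" "i < dims l" "j < dims (l - 1)" for l i j
      using grad_risk_eq[OF that, of ?U] by (simp add: D_def power2_eq_square)
    then show ?thesis
      unfolding lin_top[of dims L, OF dims_L] gradsq_def fnorm_sq sum_distrib_left
      by (intro sum.cong refl) auto
  qed
  also have "?E * (\<eta> t * sqrt (gradsq ?U))\<^sup>2 = (\<eta> t * ?E) * (\<eta> t * gradsq ?U)"
    by (simp add: power_mult_distrib gradsq_nonneg power2_eq_square)
  also have "\<dots> \<le> 1 / 2 * (\<eta> t * gradsq ?U)"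
    using eta_smooth[of t] eta_pos[of t] gradsq_nonneg by (intro mult_right_mono) auto
  finally show ?thesis by simp
qed

section \<open>Balancedness along the iterates\<close>

text \<open>Both sides are the upper product at layer k times the lower output at layer k for input
  \<open>gvec\<close>. Hence the terms of first order in \<eta> cancel in the change of the
  imbalance.\<close>

lemma grad_cross:
  assumes "1 \<le> k" "k < L" "i < dims k" "j < dims k"
  shows "(\<Sum>m<dims (Suc k). V (Suc k) m i * Grad V (Suc k) m j) = (\<Sum>m<dims (k - 1). Grad V k i m * V k j m)"
proof -
  obtain k' where k': "k = Suc k'" using assms by (cases k) auto
  have "(\<Sum>m<dims (Suc k). V (Suc k) m i * Grad V (Suc k) m j)
    = (\<Sum>m<dims (Suc k). V (Suc k) m i * (lft L dims V (Suc k) m * fwd dims V (gvec V) k j))"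
    using assms by (intro sum.cong) (auto simp: grad_risk_eq simp del: fwd.simps)
  also have "\<dots> = lft L dims V k i * fwd dims V (gvec V) k j"
    using assms by (simp add: lft_step[of k] sum_distrib_left sum_distrib_right mult_ac del: fwd.simps)
  also have "\<dots> = (\<Sum>m<dims k'. (lft L dims V k i * fwd dims V (gvec V) k' m) * V k j m)"
    by (simp add: k' sum_distrib_left mult_ac)
  also have "\<dots> = (\<Sum>m<dims (k - 1). Grad V k i m * V k j m)"
    using assms by (intro sum.cong) (auto simp: grad_risk_eq k')
  finally show ?thesis .
qed

lemma imbalance_step:
  assumes "1 \<le> k" "k < L" "i < dims k" "j < dims k"
  shows "imbalance dims (W (Suc t)) k i j = imbalance dims (W t) k i j + (\<eta> t)\<^sup>2 * imbalance dims (Grad (W t)) k i j"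
proof -
  let ?G = "Grad (W t)"
  have ex: "W (Suc t) k i m * W (Suc t) k' j' m' = W t k i m * W t k' j' m'
      - \<eta> t * (?G k i m * W t k' j' m' + W t k i m * ?G k' j' m') + (\<eta> t)\<^sup>2 * (?G k i m * ?G k' j' m')"
    for k i m k' j' m'
    by (simp add: gd[rule_format] algebra_simps power2_eq_square)
  show ?thesis
    using grad_cross[OF assms, of "W t"] grad_cross[OF assms(1,2,4,3), of "W t"]
    unfolding imbalance_def ex
    by (simp add: sum.distrib sum_subtractf right_diff_distrib distrib_left mult.commute flip: sum_distrib_left)
qed

lemma risk_pos: "0 < Risk V"
  unfolding risk_eq using n_pos loss_pos by (intro mult_pos_pos sum_pos) auto

lemma imbalance_bounded:
  assumes "1 \<le> k" "k < L" "i < dims k" "j < dims k"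
  shows "\<bar>imbalance dims (W t) k i j\<bar> \<le> \<bar>imbalance dims (W 0) k i j\<bar> + 4 * Risk (W 0)"
proof -
  \<comment> \<open>This potential does not increase. The imbalance of the gradient is at most twice
    its squared norm, \<eta>^2 is at most \<eta>, and \<eta> times the squared gradient norm is at
    most twice the decrease of the risk: hence the factor 4.\<close>
  have "\<bar>imbalance dims (W t) k i j\<bar> + 4 * Risk (W t) \<le> \<bar>imbalance dims (W 0) k i j\<bar> + 4 * Risk (W 0)"
  proof (induction t)
    case (Suc t)
    have "\<bar>imbalance dims (Grad (W t)) k i j\<bar> \<le> 2 * gradsq (W t)"
      using abs_imbalance_le[of i dims k j "Grad (W t)"] assms
        fnorm_grad_sq_le[of k "W t"] fnorm_grad_sq_le[of "Suc k" "W t"] by simp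
    then have "(\<eta> t)\<^sup>2 * \<bar>imbalance dims (Grad (W t)) k i j\<bar> \<le> \<eta> t * (2 * gradsq (W t))"
      using eta_pos[of t] eta_le_1[of t] by (intro mult_mono) (auto simp: power2_eq_square)
    also have "\<dots> \<le> 4 * (Risk (W t) - Risk (W (Suc t)))"
      using descent[of t] by (simp add: field_simps)
    finally have "\<bar>imbalance dims (W (Suc t)) k i j\<bar> \<le> \<bar>imbalance dims (W t) k i j\<bar> + 4 * (Risk (W t) - Risk (W (Suc t)))"
      unfolding imbalance_step[OF assms] by (intro order_trans[OF abs_triangle_ineq]) (simp add: abs_mult)
    then show ?case using Suc by simp
  qed simp
  then show ?thesis using risk_pos[of "W t"] by simp
qed

text \<open>Adjacent layers are compared through the trace of the imbalance, and the differences are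
  summed along the chain of layers.\<close>

lemma layers_balanced:
  obtains D where "0 \<le> D"
    "\<And>t j k. j \<in> {1..L} \<Longrightarrow> k \<in> {1..L} \<Longrightarrow> (fnorm dims (W t) j)\<^sup>2 \<le> (fnorm dims (W t) k)\<^sup>2 + D"
proof
  define C where "C k = (\<Sum>i<dims k. \<bar>imbalance dims (W 0) k i i\<bar> + 4 * Risk (W 0))" for k
  have C: "0 \<le> C k" for k
    unfolding C_def using risk_pos[of "W 0"] by (intro sum_nonneg) auto
  show "0 \<le> (\<Sum>l=1..<L. C l)" by (intro sum_nonneg C)
  have adj: "\<bar>(fnorm dims (W t) (Suc k))\<^sup>2 - (fnorm dims (W t) k)\<^sup>2\<bar> \<le> C k" if "1 \<le> k" "k < L" for t k
    unfolding sum_imbalance[symmetric] C_def using that by (intro order_trans[OF sum_abs] sum_mono imbalance_bounded) auto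
  have up: "\<bar>(fnorm dims (W t) k)\<^sup>2 - (fnorm dims (W t) j)\<^sup>2\<bar> \<le> (\<Sum>l=1..<L. C l)"
    if "1 \<le> j" "j \<le> k" "k \<le> L" for t j k
  proof -
    have "\<bar>(fnorm dims (W t) k)\<^sup>2 - (fnorm dims (W t) j)\<^sup>2\<bar> \<le> (\<Sum>l=j..<k. C l)"
      using that(2,3)
    proof (induction k rule: dec_induct)
      case (step k)
      then show ?case using adj[of k t] that(1) by simp
    qed simp
    also have "\<dots> \<le> (\<Sum>l=1..<L. C l)"
      using that C by (intro sum_mono2) auto
    finally show ?thesis .
  qed
  show "(fnorm dims (W t) j)\<^sup>2 \<le> (fnorm dims (W t) k)\<^sup>2 + (\<Sum>l=1..<L. C l)"
    if "j \<in> {1..L}" "k \<in> {1..L}" for t j k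
    using up[of j k t] up[of k j t] that by (cases "j \<le> k") auto
qed

section \<open>Lower bounds for the product vector and for the gradient\<close>

lemma risk_Suc_le: "Risk (W (Suc t)) \<le> Risk (W t)"
  using descent[of t] eta_pos[of t] gradsq_nonneg[of "W t"]
  by (smt (verit) divide_pos_pos mult_nonneg_nonneg)

lemma risk_antimono: "s \<le> t \<Longrightarrow> Risk (W t) \<le> Risk (W s)"
  by (rule lift_Suc_antimono_le[where f = "\<lambda>t. Risk (W t)", OF risk_Suc_le])

text \<open>The first step starts at a nonzero gradient and so decreases the risk strictly. This gap
  below \<open>loss 0\<close> keeps the product vector away from zero afterwards.\<close>

lemma risk_1_less: "Risk (W (Suc 0)) < loss 0"
proof -
  obtain k i j where kij: "k \<in> {1..L}" "i < dims k" "j < dims (k - 1)" "Grad (W 0) k i j \<noteq> 0"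
    using grad0 by blast
  have "fnorm dims (Grad (W 0)) k \<noteq> 0"
  proof
    assume "fnorm dims (Grad (W 0)) k = 0"
    then have "(\<Sum>i<dims k. \<Sum>j<dims (k - 1). (Grad (W 0) k i j)\<^sup>2) = 0"
      using fnorm_sq[of dims "Grad (W 0)" k] by simp
    then show False
      using kij by (simp add: sum_nonneg_eq_0_iff sum_nonneg)
  qed
  then have "0 < gradsq (W 0)"
    using fnorm_grad_sq_le[OF kij(1), of "W 0"] by (smt (verit) zero_less_power2)
  then have "0 < \<eta> 0 / 2 * gradsq (W 0)"
    using eta_pos[of 0] by simp
  then show ?thesis using descent[of 0] risk0 by linarith
qed

lemma fwd_le_wprod:
  assumes "i < n"
  shows "\<bar>fwd dims V (z i) L 0\<bar> \<le> L2_set (wprod L dims V) {..<dims 0}"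
proof -
  have "\<bar>fwd dims V (z i) L 0\<bar> \<le> L2_set (wprod L dims V) {..<dims 0} * L2_set (z i) {..<dims 0}"
    using wprod_inner[of dims L V "z i", OF dims_L] abs_inner_le_L2_set[of "wprod L dims V" "z i" "{..<dims 0}"]
    by simp
  also have "\<dots> \<le> L2_set (wprod L dims V) {..<dims 0} * 1"
    using z_norm[OF assms] by (intro mult_left_mono) auto
  finally show ?thesis by simp
qed

text \<open>The loss is \<open>G\<close>-Lipschitz and every margin is bounded by the norm of the
  product vector. Thus a risk below \<open>loss 0\<close> forces that norm to be positive.\<close>

lemma risk_wprod_lower: "loss 0 - G * L2_set (wprod L dims V) {..<dims 0} \<le> Risk V"
proof -
  let ?B = "loss 0 - G * L2_set (wprod L dims V) {..<dims 0}"
  have "?B \<le> loss (fwd dims V (z i) L 0)" if "i < n" for i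
  proof -
    let ?s = "fwd dims V (z i) L 0"
    obtain c where c: "loss ?s - loss 0 = loss' c * ?s"
      using loss_mvt[of 0 ?s] by auto
    have "\<bar>loss' c * ?s\<bar> \<le> G * L2_set (wprod L dims V) {..<dims 0}"
      unfolding abs_mult using bnd G_pos fwd_le_wprod[OF that] by (intro mult_mono) auto
    then show ?thesis using c by linarith
  qed
  then have "(1 / real n) * (\<Sum>i<n. ?B) \<le> Risk V"
    unfolding risk_eq by (intro mult_left_mono sum_mono) auto
  then show ?thesis using n_pos by simp
qed

lemma L2_set_wprod: "L2_set (wprod L dims V) {..<dims 0} = L2_set (lft L dims V 0) {..<dims 0}"
  by (intro L2_set_cong refl wprod_eq_lft[of dims L, OF dims_L]) auto

lemma wprod_le_first_layer:
  "L2_set (wprod L dims V) {..<dims 0} \<le> fnorm dims V 1 * L2_set (lft L dims V 1) {..<dims 1}"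
  using L2_set_layer_transpose[where dims = dims and k = 0 and W = V and u = "lft L dims V 1"] L
  unfolding L2_set_wprod by (simp add: lft_step[of 0] L2_set_def)

text \<open>Some sample has loss at least c, and no loss exceeds n times M, so the margin of this
  sample lies in a compact interval, on which the slope of the loss stays away from zero. Pairing
  \<open>gvec\<close> with a separating vector then gives the bound.\<close>

lemma gvec_lower:
  assumes "0 < c"
  obtains K where "0 < K"
    "\<And>V. c \<le> Risk V \<Longrightarrow> Risk V \<le> M \<Longrightarrow> K \<le> L2_set (gvec V) {..<dims 0}"
proof -
  obtain u where u: "\<And>i. i < n \<Longrightarrow> 0 < (\<Sum>j<dims 0. u j * z i j)"
    using separable unfolding z_def by blast
  define \<gamma> where "\<gamma> = Min ((\<lambda>i. \<Sum>j<dims 0. u j * z i j) ` {..<n})"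
  have \<gamma>: "0 < \<gamma>" unfolding \<gamma>_def using n_pos u by (subst Min_gr_iff) auto
  have \<gamma>_le: "\<gamma> \<le> (\<Sum>j<dims 0. u j * z i j)" if "i < n" for i
    unfolding \<gamma>_def using that by (intro Min_le) auto
  obtain a where a: "\<And>s. s \<le> a \<Longrightarrow> real n * M < loss s"
    using filterlim_at_top_dense[THEN iffD1, OF loss_bot, rule_format, of "real n * M"]
    unfolding eventually_at_bot_linorder by blast
  obtain b where b: "loss b < c"
    using order_tendstoD(2)[OF loss_top assms] unfolding eventually_at_top_linorder by blast
  \<comment> \<open>The maximum with a keeps the interval nonempty.\<close>
  have "\<exists>s0\<in>{a..max a b}. \<forall>s\<in>{a..max a b}. loss' s \<le> loss' s0"
    by (rule continuous_attains_sup) (auto intro: continuous_on_subset[OF loss'_cont])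
  then obtain s0 where s0: "\<And>s. s \<in> {a..max a b} \<Longrightarrow> loss' s \<le> loss' s0" by blast
  define \<kappa> where "\<kappa> = - loss' s0"
  have \<kappa>: "0 < \<kappa>" using loss'_neg by (simp add: \<kappa>_def)
  \<comment> \<open>The summand 1 makes the denominator positive without a look at u.\<close>
  define K where "K = \<kappa> * \<gamma> / real n / (L2_set u {..<dims 0} + 1)"
  have pos: "0 < L2_set u {..<dims 0} + 1"
    by (intro add_nonneg_pos) auto
  show ?thesis
  proof
    show "0 < K" unfolding K_def using \<kappa> \<gamma> n_pos pos by simp
    fix V assume V: "c \<le> Risk V" "Risk V \<le> M"
    let ?f = "\<lambda>i. fwd dims V (z i) L 0"
    have tot: "(\<Sum>i<n. loss (?f i)) = real n * Risk V"
      using n_pos by (simp add: risk_eq)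
    have "\<exists>i<n. c \<le> loss (?f i)"
    proof (rule ccontr)
      assume "\<not> ?thesis"
      then have "(\<Sum>i<n. loss (?f i)) < (\<Sum>i<n. c)"
        using n_pos by (intro sum_strict_mono) auto
      then show False using V n_pos tot by simp
    qed
    then obtain i where i: "i < n" "c \<le> loss (?f i)" by blast
    have "loss (?f i) \<le> (\<Sum>i<n. loss (?f i))"
      using i loss_pos by (intro member_le_sum) (auto intro: less_imp_le)
    also have "\<dots> \<le> real n * M" using V tot by (simp add: mult_left_mono)
    finally have "a \<le> ?f i" using a[of "?f i"] by linarith
    moreover have "?f i \<le> b" using i b loss_antimono[of b "?f i"] by linarith
    ultimately have k: "\<kappa> \<le> - loss' (?f i)" using s0[of "?f i"] by (simp add: \<kappa>_def)
    have "\<kappa> * \<gamma> / real n \<le> (- loss' (?f i) / real n) * (\<Sum>j<dims 0. u j * z i j)"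
      using k \<kappa> \<gamma> \<gamma>_le[OF i(1)] divide_right_mono[OF mult_mono, of \<kappa> "- loss' (?f i)" \<gamma> _ "real n"]
      by simp
    \<comment> \<open>By separability and the negative slope of the loss all summands are positive,
      so the controlled sample bounds the sum from below.\<close>
    also have "\<dots> \<le> (\<Sum>i<n. (- loss' (?f i) / real n) * (\<Sum>j<dims 0. u j * z i j))"
      using i loss'_neg u
      by (intro member_le_sum[of i "{..<n}" "\<lambda>i. (- loss' (?f i) / real n) * (\<Sum>j<dims 0. u j * z i j)"])
        (auto intro!: less_imp_le divide_neg_pos mult_neg_pos simp: n_pos)
    also have "\<dots> = - (\<Sum>j<dims 0. gvec V j * u j)"
    proof -
      have "(\<Sum>j<dims 0. gvec V j * u j) = (\<Sum>j<dims 0. \<Sum>i<n. (loss' (?f i) / real n) * z i j * u j)"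
        by (simp add: gvec_def sum_distrib_right)
      also have "\<dots> = (\<Sum>i<n. \<Sum>j<dims 0. (loss' (?f i) / real n) * z i j * u j)"
        by (rule sum.swap)
      finally show ?thesis
        by (simp add: sum_distrib_left sum_negf sum_divide_distrib mult_ac)
    qed
    also have "\<dots> \<le> L2_set (gvec V) {..<dims 0} * L2_set u {..<dims 0}"
      using abs_inner_le_L2_set[of "gvec V" u "{..<dims 0}"] by linarith
    also have "\<dots> \<le> L2_set (gvec V) {..<dims 0} * (L2_set u {..<dims 0} + 1)"
      by (intro mult_left_mono) auto
    finally show "K \<le> L2_set (gvec V) {..<dims 0}"
      unfolding K_def pos_divide_le_eq[OF pos] .
  qed
qed


section \<open>Vanishing risk and growth of the layers\<close>

lemma fnorm_Suc_le: "fnorm dims (W (Suc t)) k \<le> fnorm dims (W t) k + \<eta> t * fnorm dims (Grad (W t)) k"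
proof -
  have "fnorm dims (\<lambda>k i j. - \<eta> t * Grad (W t) k i j) k = \<eta> t * fnorm dims (Grad (W t)) k"
    using eta_pos[of t]
    by (simp add: fnorm_def power_mult_distrib real_sqrt_mult flip: sum_distrib_left)
  then show ?thesis
    using fnorm_triangle[where dims = dims and k = k and V = "W (Suc t)" and W = "W t"
        and D = "\<lambda>k i j. - \<eta> t * Grad (W t) k i j"]
    by (simp add: gd[rule_format])
qed

text \<open>Radii are never changed once they exceed the bound on the iterates, so step sizes stay away from zero.\<close>

lemma eta_lower:
  assumes "\<And>t k. k \<in> {1..L} \<Longrightarrow> fnorm dims (W (Suc t)) k \<le> B"
  obtains \<eta>0 T where "0 < \<eta>0" "\<And>t. T \<le> t \<Longrightarrow> \<eta>0 \<le> \<eta> t"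
proof (cases "\<forall>t. Rad t \<le> B + 1")
  case True
  let ?E = "\<lambda>R. 2 * real L ^ 2 * R ^ (2 * L - 2) * (\<beta> + G)"
  have E: "0 < ?E (Rad t)" for t using smooth_pos[of t] by (simp add: mult.assoc)
  have le: "?E (Rad t) \<le> ?E (B + 1)" for t
    using True Rad_ge_1[of t] beta_nonneg G_pos
    by (intro mult_right_mono mult_left_mono power_mono) auto
  have EB: "0 < ?E (B + 1)" using less_le_trans[OF E le] .
  have "1 / ?E (B + 1) \<le> 1 / ?E (Rad t)" for t
    by (rule divide_left_mono[OF le _ mult_pos_pos[OF EB E]]) simp
  then have "min (1 / ?E (B + 1)) 1 \<le> \<eta> t" for t
    using step by (simp add: min.coboundedI1)
  then show ?thesis using EB by (intro that[of "min (1 / ?E (B + 1)) 1"]) auto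
next
  case False
  then obtain T where T: "B + 1 < Rad T" by (auto simp: not_le)
  have RT: "Rad t = Rad T" if "T \<le> t" for t
    using that
  proof (induction t rule: dec_induct)
    case (step t)
    have "in_ball L dims (Rad t - 1) (W (Suc t))"
      unfolding in_ball_def
    proof
      fix k assume "k \<in> {1..L}"
      from assms[OF this, of t] show "fnorm dims (W (Suc t)) k \<le> Rad t - 1"
        using T step.IH by simp
    qed
    then show ?case using radii_const step.IH by simp
  qed simp
  have "\<eta> T \<le> \<eta> t" if "T \<le> t" for t using step RT[OF that] by simp
  with eta_pos[of T] show ?thesis by (rule that)
qed

text \<open>As long as the risk exceeds \<open>c\<close>, each step decreases it by at least a constant multiple of the
  increase of \<open>ln \<parallel>W\<^sub>1\<parallel>\<close>. Hence \<open>W\<^sub>1\<close>, and by balancedness every layer, stays bounded, so that the step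
  sizes and the gradient stay away from zero.\<close>

lemma risk_arbitrarily_small:
  assumes c: "0 < c"
  shows "\<exists>t. Risk (W t) < c"
proof (rule ccontr)
  assume "\<not> ?thesis"
  then have ge: "c \<le> Risk (W t)" for t by (simp add: not_less)
  obtain K where K: "0 < K" "\<And>t. K \<le> L2_set (gvec (W t)) {..<dims 0}"
    using gvec_lower[OF c, of "Risk (W 0)"] ge risk_antimono[of 0] by (metis le0)
  \<comment> \<open>By \<open>risk_wprod_lower\<close> this bounds the norm of the product vector
    from below at all times after the first step. The sequences below are shifted by one for this
    reason.\<close>
  define \<delta> where "\<delta> = (loss 0 - Risk (W (Suc 0))) / G"
  have \<delta>: "0 < \<delta>" unfolding \<delta>_def using risk_1_less G_pos by simp
  define f where "f t = fnorm dims (W (Suc t)) 1" for t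
  define m where "m t = fnorm dims (Grad (W (Suc t))) 1" for t
  define r where "r t = Risk (W (Suc t))" for t
  \<comment> \<open>\<open>m t\<close> is the norm of the product of the layers above the first,
    times the norm of \<open>gvec\<close>; \<open>wprod_le_first_layer\<close> bounds the former
    below by \<delta> divided by \<open>f t\<close>.\<close>
  have mf: "K * \<delta> \<le> m t * f t" for t
  proof -
    let ?l = "L2_set (lft L dims (W (Suc t)) 1) {..<dims 1}"
    have "loss 0 - Risk (W (Suc 0)) \<le> G * L2_set (wprod L dims (W (Suc t))) {..<dims 0}"
      using risk_wprod_lower[of "W (Suc t)"] risk_antimono[of "Suc 0" "Suc t"] by simp
    then have "\<delta> \<le> L2_set (wprod L dims (W (Suc t))) {..<dims 0}"
      unfolding \<delta>_def using G_pos by (simp add: pos_divide_le_eq mult.commute)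
    also have "\<dots> \<le> f t * ?l"
      unfolding f_def by (rule wprod_le_first_layer)
    finally have "K * \<delta> \<le> K * (f t * ?l)"
      using K(1) by (intro mult_left_mono) auto
    also have "\<dots> = K * ?l * f t" by simp
    also have "\<dots> \<le> L2_set (gvec (W (Suc t))) {..<dims 0} * ?l * f t"
      using K(2)[of "Suc t"] by (intro mult_right_mono) (auto simp: f_def)
    also have "L2_set (gvec (W (Suc t))) {..<dims 0} = L2_set (fwd dims (W (Suc t)) (gvec (W (Suc t))) 0) {..<dims 0}"
      by (simp add: L2_set_def)
    also have "\<dots> * ?l * f t = m t * f t"
      using fnorm_grad[of 1 "W (Suc t)"] L by (simp add: m_def mult.commute del: fwd.simps)
    finally show ?thesis .
  qed
  have Kd: "0 < K * \<delta>" using K \<delta> by simp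
  have m0: "0 \<le> m t" for t by (simp add: m_def)
  have f: "0 < f t" for t
    using mf[of t] Kd fnorm_nonneg[of dims "W (Suc t)" 1] by (cases "f t = 0") (auto simp: f_def less_le)
  have dec: "\<eta> (Suc t) / 2 * (m t)\<^sup>2 \<le> r t - r (Suc t)" for t
  proof -
    have "\<eta> (Suc t) / 2 * (m t)\<^sup>2 \<le> \<eta> (Suc t) / 2 * gradsq (W (Suc t))"
      unfolding m_def using eta_pos[of "Suc t"] L by (intro mult_left_mono fnorm_grad_sq_le) auto
    then show ?thesis using descent[of "Suc t"] by (simp add: r_def)
  qed
  \<comment> \<open>The logarithm grows by at most \<eta> m / f, as ln (1 + u) is at most u. By
    \<open>mf\<close> this is at most \<eta> m^2 / (K \<delta>), and \<open>dec\<close> bounds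
    \<eta> m^2 by twice the decrease of the risk.\<close>
  have ln_step: "ln (f (Suc t)) + 2 / (K * \<delta>) * r (Suc t) \<le> ln (f t) + 2 / (K * \<delta>) * r t" for t
  proof -
    have fS: "f (Suc t) \<le> f t * (1 + \<eta> (Suc t) * m t / f t)"
      using fnorm_Suc_le[of "Suc t" 1] f[of t] by (simp add: f_def m_def distrib_left)
    have pos: "0 \<le> \<eta> (Suc t) * m t / f t"
      using f[of t] eta_pos[of "Suc t"] m0[of t] by simp
    have "ln (f (Suc t)) \<le> ln (f t * (1 + \<eta> (Suc t) * m t / f t))"
      using fS f[of t] f[of "Suc t"] by simp
    also have "\<dots> = ln (f t) + ln (1 + \<eta> (Suc t) * m t / f t)"
      using f[of t] pos by (intro ln_mult_pos) auto
    also have "\<dots> \<le> ln (f t) + \<eta> (Suc t) * m t / f t"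
      using ln_add_one_self_le_self[OF pos] by simp
    also have "\<eta> (Suc t) * m t / f t \<le> 2 / (K * \<delta>) * (\<eta> (Suc t) / 2 * (m t)\<^sup>2)"
    proof -
      have "\<eta> (Suc t) * m t * (K * \<delta>) \<le> \<eta> (Suc t) * m t * (m t * f t)"
        using mf[of t] eta_pos[of "Suc t"] m0[of t] by (intro mult_left_mono) auto
      then show ?thesis using Kd f[of t] by (simp add: field_simps power2_eq_square)
    qed
    also have "\<dots> \<le> 2 / (K * \<delta>) * (r t - r (Suc t))"
      using dec[of t] Kd by (intro mult_left_mono) auto
    finally show ?thesis unfolding right_diff_distrib by linarith
  qed
  have lnb: "ln (f t) + 2 / (K * \<delta>) * r t \<le> ln (f 0) + 2 / (K * \<delta>) * r 0" for t
    using lift_Suc_antimono_le[of "\<lambda>t. ln (f t) + 2 / (K * \<delta>) * r t" 0 t, OF ln_step] by simp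
  have nn: "0 \<le> 2 / (K * \<delta>) * r t" for t
    using Kd risk_pos[of "W (Suc t)"] by (simp add: r_def)
  have "ln (f t) \<le> ln (f 0) + 2 / (K * \<delta>) * r 0" for t
    using lnb[of t] nn[of t] by linarith
  then have fB: "f t \<le> exp (ln (f 0) + 2 / (K * \<delta>) * r 0)" for t
    using f[of t] by (metis exp_ln exp_le_cancel_iff)
  define B1 where "B1 = exp (ln (f 0) + 2 / (K * \<delta>) * r 0)"
  have B1: "0 < B1" "\<And>t. f t \<le> B1" using fB by (auto simp: B1_def)
  obtain D where D: "0 \<le> D" "\<And>t j k. j \<in> {1..L} \<Longrightarrow> k \<in> {1..L} \<Longrightarrow> (fnorm dims (W t) j)\<^sup>2 \<le> (fnorm dims (W t) k)\<^sup>2 + D"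
    using layers_balanced by blast
  have "fnorm dims (W (Suc t)) k \<le> sqrt (B1\<^sup>2 + D)" if "k \<in> {1..L}" for t k
  proof (rule real_le_rsqrt)
    have "(f t)\<^sup>2 \<le> B1\<^sup>2" using B1(2)[of t] f[of t] by (intro power_mono) auto
    then show "(fnorm dims (W (Suc t)) k)\<^sup>2 \<le> B1\<^sup>2 + D"
      using D(2)[of k 1 "Suc t"] that by (simp add: f_def)
  qed
  then obtain \<eta>0 T where e: "0 < \<eta>0" "\<And>t. T \<le> t \<Longrightarrow> \<eta>0 \<le> \<eta> t"
    using eta_lower by blast
  \<comment> \<open>The guaranteed decrease per step from time T on, where \<eta> is at least
    \<open>\<eta>0\<close> and \<open>m t\<close> at least K \<delta> / \<open>B1\<close>.\<close>
  define \<epsilon> where "\<epsilon> = \<eta>0 / 2 * (K * \<delta> / B1)\<^sup>2"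
  have \<epsilon>: "0 < \<epsilon>" unfolding \<epsilon>_def by (intro mult_pos_pos divide_pos_pos zero_less_power e K(1) \<delta> B1) simp
  have drop: "r (Suc t) \<le> r t - \<epsilon>" if "T \<le> t" for t
  proof -
    have "K * \<delta> \<le> m t * B1"
      using mf[of t] mult_left_mono[OF B1(2)[of t] m0[of t]] by (rule order_trans)
    then have "K * \<delta> / B1 \<le> m t" by (simp only: pos_divide_le_eq[OF B1(1)])
    then have "(K * \<delta> / B1)\<^sup>2 \<le> (m t)\<^sup>2" using Kd B1 by (intro power_mono) auto
    then have "\<epsilon> \<le> \<eta> (Suc t) / 2 * (m t)\<^sup>2"
      unfolding \<epsilon>_def using e(1) e(2)[of "Suc t"] that by (intro mult_mono) auto
    then show ?thesis using dec[of t] by simp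
  qed
  have "r (T + s) \<le> r T - real s * \<epsilon>" for s
  proof (induction s)
    case (Suc s)
    then show ?case using drop[of "T + s"] by (simp add: algebra_simps)
  qed simp
  moreover obtain s where "r T < real s * \<epsilon>"
    using reals_Archimedean3[OF \<epsilon>] by blast
  ultimately have "r (T + s) < 0" by (meson diff_less_0_iff_less le_less_trans)
  then show False using risk_pos[of "W (Suc (T + s))"] by (simp add: r_def)
qed

lemma risk_tendsto_zero: "(\<lambda>t. Risk (W t)) \<longlonglongrightarrow> 0"
proof (rule order_tendstoI)
  fix c :: real assume "0 < c"
  then obtain s where "Risk (W s) < c" using risk_arbitrarily_small by blast
  then show "\<forall>\<^sub>F t in sequentially. Risk (W t) < c"
    unfolding eventually_sequentially by (meson risk_antimono le_less_trans)
qed (auto intro!: always_eventually intro: less_trans[OF _ risk_pos])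

text \<open>A small risk forces a large margin, hence a large product vector. If one layer stayed
  small, balancedness would keep all layers, and so the product vector, bounded.\<close>

lemma fnorm_at_top:
  assumes k: "k \<in> {1..L}"
  shows "filterlim (\<lambda>t. fnorm dims (W t) k) at_top sequentially"
  unfolding filterlim_at_top_ge[where c = 0]
proof (intro allI impI)
  fix Z :: real assume Z: "0 \<le> Z"
  obtain D where D: "0 \<le> D" "\<And>t j k. j \<in> {1..L} \<Longrightarrow> k \<in> {1..L} \<Longrightarrow> (fnorm dims (W t) j)\<^sup>2 \<le> (fnorm dims (W t) k)\<^sup>2 + D"
    using layers_balanced by blast
  \<comment> \<open>The bound on the product vector that would follow if layer k had norm at most
    Z.\<close>
  define B where "B = sqrt (Z\<^sup>2 + D) ^ L"
  have "0 < loss B / real n" using loss_pos n_pos by simp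
  then have "\<forall>\<^sub>F t in sequentially. Risk (W t) < loss B / real n"
    by (rule order_tendstoD(2)[OF risk_tendsto_zero])
  then show "\<forall>\<^sub>F t in sequentially. Z \<le> fnorm dims (W t) k"
  proof eventually_elim
    case (elim t)
    let ?s = "\<lambda>i. fwd dims (W t) (z i) L 0"
    have "loss (?s 0) \<le> (\<Sum>i<n. loss (?s i))"
      using n_pos loss_pos by (intro member_le_sum) (auto intro: less_imp_le)
    also have "\<dots> < loss B" using elim n_pos by (simp add: risk_eq divide_less_cancel)
    finally have "B < ?s 0" using loss_antimono[of "?s 0" B] by linarith
    then have Bw: "B < L2_set (wprod L dims (W t)) {..<dims 0}"
      using fwd_le_wprod[OF n_pos, of "W t"] by linarith
    show ?case
    proof (rule ccontr)
      assume "\<not> ?thesis"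
      then have "(fnorm dims (W t) k)\<^sup>2 \<le> Z\<^sup>2" by (intro power_mono) auto
      then have "fnorm dims (W t) j \<le> sqrt (Z\<^sup>2 + D)" if "j \<in> {1..L}" for j
        using D(2)[OF that k, of t] by (intro real_le_rsqrt) linarith
      then have "in_ball L dims (sqrt (Z\<^sup>2 + D)) (W t)"
        unfolding in_ball_def by blast
      from L2_set_lft_le[OF this, of 0] have "L2_set (wprod L dims (W t)) {..<dims 0} \<le> B"
        using dims_L by (simp add: B_def L2_set_wprod)
      then show False using Bw by simp
    qed
  qed
qed

section \<open>Normalised layers and alignment\<close>

definition unit_net :: "net \<Rightarrow> net" where
  "unit_net V k i j = V k i j / fnorm dims V k"

lemma prodmat_unit_net:
  "prodmat L dims (unit_net V) k i j = prodmat L dims V k i j / (\<Prod>l=1..k. fnorm dims V l)"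
  by (induction k arbitrary: i) (simp_all add: unit_net_def mult.commute sum_divide_distrib)

lemma fnorm_unit_net: "fnorm dims V k \<noteq> 0 \<Longrightarrow> fnorm dims (unit_net V) k = 1"
  by (simp add: fnorm_def unit_net_def power_divide real_sqrt_divide sum_nonneg flip: sum_divide_distrib)

lemma fnorm_unit_net_tendsto:
  assumes "k \<in> {1..L}"
  shows "(\<lambda>t. (fnorm dims (unit_net (W t)) k)\<^sup>2) \<longlonglongrightarrow> 1"
proof (rule Lim_transform_eventually[OF tendsto_const])
  have "\<forall>\<^sub>F t in sequentially. 0 < fnorm dims (W t) k"
    using fnorm_at_top[OF assms] by (simp add: filterlim_at_top_dense)
  then show "\<forall>\<^sub>F t in sequentially. 1 = (fnorm dims (unit_net (W t)) k)\<^sup>2"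
    by eventually_elim (simp add: fnorm_unit_net)
qed

text \<open>The two Gram matrices are divided by different squared norms. Over the common
  denominator of layer k + 1 the numerator is the original imbalance plus s times the difference of
  the squared norms. Both are bounded, while the denominator grows without bound.\<close>

lemma imbalance_unit_net_tendsto:
  assumes k: "1 \<le> k" "k < L" and ij: "i < dims k" "j < dims k"
  shows "(\<lambda>t. imbalance dims (unit_net (W t)) k i j) \<longlonglongrightarrow> 0"
proof -
  let ?f = "\<lambda>k t. fnorm dims (W t) k"
  define s where "s t = (\<Sum>m<dims (k - 1). unit_net (W t) k i m * unit_net (W t) k j m)" for t
  have top: "filterlim (?f l) at_top sequentially" if "l \<in> {k, Suc k}" for l
    using that k by (intro fnorm_at_top) auto
  have inv: "(\<lambda>t. 1 / (?f (Suc k) t)\<^sup>2) \<longlonglongrightarrow> 0"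
    using tendsto_power[OF tendsto_inverse_0_at_top[OF top[of "Suc k"]], of 2]
    by (simp add: divide_inverse power_inverse)
  have Bgap: "Bseq (\<lambda>t. imbalance dims (W t) k i j)"
    using imbalance_bounded[OF k ij] by (intro BseqI') auto
  have Bs: "Bseq s"
  proof (rule BseqI')
    fix t
    \<comment> \<open>Division by zero makes a vanishing layer normalise to zero, so the bound holds
      at every time.\<close>
    have le1: "fnorm dims (unit_net (W t)) k \<le> 1"
      using fnorm_unit_net[of "W t" k] by (cases "fnorm dims (W t) k = 0") (auto simp: fnorm_def unit_net_def)
    have "\<bar>s t\<bar> \<le> fnorm dims (unit_net (W t)) k * fnorm dims (unit_net (W t)) k"
      unfolding s_def using ij by (intro order_trans[OF abs_inner_le_L2_set] mult_mono L2_set_row_le) auto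
    also have "\<dots> \<le> 1 * 1" using le1 by (intro mult_mono) auto
    finally show "norm (s t) \<le> 1" by simp
  qed
  obtain D where D: "0 \<le> D" "\<And>t j k. j \<in> {1..L} \<Longrightarrow> k \<in> {1..L} \<Longrightarrow> (fnorm dims (W t) j)\<^sup>2 \<le> (fnorm dims (W t) k)\<^sup>2 + D"
    using layers_balanced by blast
  have "Bseq (\<lambda>t. (?f k t)\<^sup>2 - (?f (Suc k) t)\<^sup>2)"
  proof (rule BseqI')
    fix t show "norm ((?f k t)\<^sup>2 - (?f (Suc k) t)\<^sup>2) \<le> D"
      using D(2)[of k "Suc k" t] D(2)[of "Suc k" k t] k by auto
  qed
  then have B: "Bseq (\<lambda>t. s t * ((?f k t)\<^sup>2 - (?f (Suc k) t)\<^sup>2))" by (intro Bseq_mult Bs)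
  have lim: "(\<lambda>t. (imbalance dims (W t) k i j + s t * ((?f k t)\<^sup>2 - (?f (Suc k) t)\<^sup>2)) * (1 / (?f (Suc k) t)\<^sup>2)) \<longlonglongrightarrow> 0"
    by (intro tendsto_zero_Bseq_mult inv Bseq_plus Bgap B)
  have "\<forall>\<^sub>F t in sequentially. 0 < ?f k t" "\<forall>\<^sub>F t in sequentially. 0 < ?f (Suc k) t"
    using top by (auto simp: filterlim_at_top_dense)
  then have "\<forall>\<^sub>F t in sequentially. (imbalance dims (W t) k i j + s t * ((?f k t)\<^sup>2 - (?f (Suc k) t)\<^sup>2)) * (1 / (?f (Suc k) t)\<^sup>2)
     = imbalance dims (unit_net (W t)) k i j"
  proof eventually_elim
    case (elim t)
    define c where "c = (\<Sum>m<dims (Suc k). W t (Suc k) m i * W t (Suc k) m j)"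
    define d where "d = (\<Sum>m<dims (k - 1). W t k i m * W t k j m)"
    have s: "s t = d / (?f k t)\<^sup>2"
      by (simp add: s_def d_def unit_net_def power2_eq_square sum_divide_distrib)
    have g: "imbalance dims (W t) k i j = c - d" by (simp add: imbalance_def c_def d_def)
    have "imbalance dims (unit_net (W t)) k i j = c / (?f (Suc k) t)\<^sup>2 - d / (?f k t)\<^sup>2"
      by (simp add: imbalance_def c_def d_def unit_net_def power2_eq_square sum_divide_distrib)
    then show ?case unfolding s g using elim by (simp add: field_simps)
  qed
  with lim show ?thesis by (rule Lim_transform_eventually)
qed

text \<open>The product vector divided by all layer norms is the product vector of the normalised
  network. Its first layer is asymptotically q p^T, with p this very vector, so
  \<open>right_singular_limit\<close> applies.\<close>

lemma alignment:
  assumes v: "\<And>t. first_right_sing_vec dims (W t) (v t)"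
  shows "(\<lambda>t. \<bar>\<Sum>j<dims 0. wprod L dims (W t) j / (\<Prod>k=1..L. fnorm dims (W t) k) * v t j\<bar>) \<longlonglongrightarrow> 1"
proof -
  let ?N = "\<lambda>t. unit_net (W t)"
  let ?q = "\<lambda>t. lft L dims (?N t) 1"
  let ?p = "\<lambda>t. lft L dims (?N t) 0"
  have L1: "1 \<le> L" using L by simp
  have un: "(\<lambda>t. \<Sum>i<dims 1. \<Sum>j<dims 0. (?N t 1 i j)\<^sup>2) \<longlonglongrightarrow> 1"
    using fnorm_unit_net_tendsto[of 1] L by (simp add: fnorm_sq)
  have p: "?p t j = (\<Sum>i<dims 1. ?q t i * ?N t 1 i j)" for t j
    using L lft_step[of 0 L] by simp
  have gram: "(\<lambda>t. (\<Sum>j<dims 0. ?N t 1 i j * ?N t 1 i' j) - ?q t i * ?q t i') \<longlonglongrightarrow> 0"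
    if "i < dims 1" "i' < dims 1" for i i'
  proof -
    have "(\<lambda>t. (\<Sum>j<dims (1 - 1). ?N t 1 i j * ?N t 1 i' j) - ?q t i * ?q t i') \<longlonglongrightarrow> 0"
      by (rule balanced_net_limit(2)[where i = i and i' = i', OF dims_L order_refl L1 _ _ that])
        (rule fnorm_unit_net_tendsto imbalance_unit_net_tendsto; assumption)+
    then show ?thesis by simp
  qed
  have max: "(\<Sum>i<dims 1. (\<Sum>j<dims 0. ?N t 1 i j * u j)\<^sup>2)
      \<le> (\<Sum>j<dims 0. (u j)\<^sup>2) * (\<Sum>i<dims 1. (\<Sum>j<dims 0. ?N t 1 i j * v t j)\<^sup>2)" for t u
  proof -
    have sc: "(\<Sum>i<dims 1. (\<Sum>j<dims 0. ?N t 1 i j * w j)\<^sup>2)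
      = (\<Sum>i<dims 1. (\<Sum>j<dims 0. W t 1 i j * w j)\<^sup>2) / (fnorm dims (W t) 1)\<^sup>2" for w
      by (simp add: unit_net_def power_divide flip: sum_divide_distrib)
    show ?thesis
      unfolding sc using divide_right_mono[OF first_right_sing_vec_homogeneous[OF v[of t], of u], of "(fnorm dims (W t) 1)\<^sup>2"]
      by simp
  qed
  have "(\<lambda>t. \<bar>\<Sum>j<dims 0. ?p t j * v t j\<bar>) \<longlonglongrightarrow> 1"
  proof (rule right_singular_limit[where q = ?q and M = "\<lambda>t. ?N t 1" and a = "dims 1"])
    show nq: "(\<lambda>t. \<Sum>i<dims 1. (?q t i)\<^sup>2) \<longlonglongrightarrow> 1" 
      using dims_L order_refl L1
      by (rule balanced_net_limit(1)) (rule fnorm_unit_net_tendsto imbalance_unit_net_tendsto; assumption)+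
    show "(\<lambda>t. \<Sum>j<dims 0. (?p t j)\<^sup>2) \<longlonglongrightarrow> 1"
      by (rule rank_one_limit_norm[OF nq un gram p])
    show "(\<lambda>t. ?N t 1 i j - ?q t i * ?p t j) \<longlonglongrightarrow> 0" if "i < dims 1" "j < dims 0" for i j
      by (rule rank_one_limit_entry[OF nq un gram p that])
    show "(\<Sum>j<dims 0. (v t j)\<^sup>2) = 1" for t
      using v[of t] by (simp add: first_right_sing_vec_def)
  qed (rule max)
  moreover have "wprod L dims (W t) j / (\<Prod>k=1..L. fnorm dims (W t) k) = ?p t j" if "j < dims 0" for t j
    using wprod_eq_lft[of dims L j "?N t", OF dims_L that] by (simp add: wprod_def prodmat_unit_net)
  ultimately show ?thesis by simp
qed

end

theorem mainTheorem12:
  fixes L n :: nat and dims :: "nat \<Rightarrow> nat"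
    and x :: "nat \<Rightarrow> nat \<Rightarrow> real" and y :: "nat \<Rightarrow> real"
    and loss loss' :: "real \<Rightarrow> real" and \<beta> G :: real
    and W :: "nat \<Rightarrow> net" and \<eta> Rad :: "nat \<Rightarrow> real"
    and v :: "nat \<Rightarrow> nat \<Rightarrow> real"
  assumes L: "L \<ge> 2"
    and dims_pos: "\<forall>k\<le>L. dims k > 0" and dims_L: "dims L = 1"
    and x_norm: "\<forall>i<n. (\<Sum>j<dims 0. (x i j)\<^sup>2) \<le> 1"
    and y_lab: "\<forall>i<n. y i = -1 \<or> y i = 1"
    and separable: "\<exists>u. \<forall>i<n. (\<Sum>j<dims 0. u j * (y i * x i j)) > 0"
    \<comment> \<open>Assumption 1\<close>
    and loss_deriv: "\<forall>s. (loss has_real_derivative loss' s) (at s)"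
    and loss'_cont: "continuous_on UNIV loss'"
    and loss'_neg: "\<forall>s. loss' s < 0"
    and loss_bot: "filterlim loss at_top at_bot"
    and loss_top: "(loss \<longlongrightarrow> 0) at_top"
    \<comment> \<open>Assumption 2\<close>
    and grad0: "\<exists>k\<in>{1..L}. \<exists>i<dims k. \<exists>j<dims (k - 1). grad_risk loss n x y L dims (W 0) k i j \<noteq> 0"
    and risk0: "risk loss n x y L dims (W 0) \<le> loss 0"
    \<comment> \<open>Assumption 4\<close>
    and lip: "\<forall>a b. \<bar>loss' a - loss' b\<bar> \<le> \<beta> * \<bar>a - b\<bar>"
    and bnd: "\<forall>s. \<bar>loss' s\<bar> \<le> G"
    \<comment> \<open>Assumption 5\<close>
    and step: "\<forall>t. \<eta> t = min (1 / (2 * real L ^ 2 * Rad t ^ (2 * L - 2) * (\<beta> + G))) 1"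
    and radii: "\<forall>t. in_ball L dims (Rad t - 1) (W t)"
    and radii_const: "\<forall>t. in_ball L dims (Rad t - 1) (W (Suc t)) \<longrightarrow> Rad (Suc t) = Rad t"
    \<comment> \<open>gradient descent\<close>
    and gd: "\<forall>t k i j. W (Suc t) k i j = W t k i j - \<eta> t * grad_risk loss n x y L dims (W t) k i j"
    \<comment> \<open>v t is a (any) first right singular vector of W_1(t)\<close>
    and sv: "\<forall>t. first_right_sing_vec dims (W t) (v t)"
  shows "((\<lambda>t. risk loss n x y L dims (W t)) \<longlongrightarrow> 0) at_top
    \<and> (\<forall>k\<in>{1..L}. filterlim (\<lambda>t. fnorm dims (W t) k) at_top at_top)
    \<and> ((\<lambda>t. \<bar>\<Sum>j<dims 0. wprod L dims (W t) j / (\<Prod>k=1..L. fnorm dims (W t) k) * v t j\<bar>)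
           \<longlongrightarrow> 1) at_top"
proof -
  interpret gd_linear_net L n dims x y loss loss' \<beta> G W \<eta> Rad
    by (rule gd_linear_net.intro; fact)
  show ?thesis
    using risk_tendsto_zero fnorm_at_top alignment sv by blast
qed

end
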